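(* Let $d\ge1$ and let $\Pi$ be an LCL on $\mathbb{Z}^d$. Then $\Pi$ is in the class $\mathsf{RTOAST}$ if and only if $\Pi$ is in the class $\mathsf{TOAST}$.
   Context: Grid and LCLs. $\mathbb{Z}^d$ denotes the infinite grid: the Cayley graph of the group $\mathbb{Z}^d$ with respect to the standard generators, each edge being oriented and labelled by its generator (isomorphisms preserve this structure). $d(\cdot,\cdot)$ is graph distance. A locally checkable problem (LCL) on $\mathbb{Z}^d$ is $\Pi=(\Sigma_{in},\Sigma_{out},t,\mathcal P)$, where $\Sigma_{in},\Sigma_{out}$ are finite sets, $t\in\mathbb N$, and $\mathcal P$ is a set of (isomorphism types of) rooted grids of radius $t$ with each vertex labelled by one label of $\Sigma_{in}$ and one of $\Sigma_{out}$. A labelling of the vertices by $\Sigma_{in}\times\Sigma_{out}$ is a $\Pi$-coloring if the $t$-hop neighborhood of every vertex is in $\mathcal P$. Toasts. For $q>0$, a $q$-toast on $\mathbb{Z}^d$ is a collection $\mathcal D$ of finite connected subsets (pieces) of $\mathbb{Z}^d$ such that (i) for all $g,h\in\mathbb{Z}^d$ there is $D\in\mathcal D$ with $g,h\in D$, and (ii) if $D,E\in\mathcal D$ and $d(\partial D,\partial E)\le q$ then $D=E$, where $\partial D$ is the boundary of $D$ (vertices of $D$ with a neighbor outside $D$). $\mathsf{TOAST}$ algorithms. A spontaneous $\mathsf{TOAST}$ algorithm for $\Pi$ is a function $\mathcal A$ defined on pairs $(A,c)$, with $A$ a finite connected $\Sigma_{in}$-labelled subset of $\mathbb{Z}^d$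 and $c$ a partial map from $A$ to $\Sigma_{out}$, such that $\mathcal A(A,c)$ is a map from all of $A$ to $\Sigma_{out}$ extending $c$ and depending only on the isomorphism type of $(A,c)$ (not on its position in $\mathbb{Z}^d$). A spontaneous randomized $\mathsf{TOAST}$ algorithm is defined in the same way except that it is additionally given as input a labelling of $A$ by real numbers from $[0,1]$ (on which it depends measurably). Given a $q$-toast $\mathcal D$ on ($\Sigma_{in}$-labelled, and in the randomized case also $[0,1]$-labelled) $\mathbb{Z}^d$, one defines inductively along inclusion $\mathcal A(D)=\mathcal A\big(D,\bigcup\{\mathcal A(E):E\subsetneq D,\ E\in\mathcal D\}\big)$ for $D\in\mathcal D$ (with the empty partial map if there is no such $E$), and $\mathcal A(\mathcal D)=\bigcup_{D\in\mathcal D}\mathcal A(D)$. Classes. $\Pi\in\mathsf{TOAST}$ if there are $q\in\mathbb N$, $q>0$, and a spontaneous $\mathsf{TOAST}$ algorithm $\mathcal A$ such that $\mathcal A(\mathcal D)$ is a $\Pi$-coloring for every $q$-toast $\mathcal D$ (and every $\Sigma_{in}$-labelling). $\Pi\in\mathsf{RTOAST}$ if there are $q\in\mathbb N$, $q>0$, and a spontaneous randomized $\mathsf{TOAST}$ algorithm $\mathcal A$ such that, for every fixed $\Sigma_{in}$-labelling of $\mathbb{Z}^d$, with probability $1$ an assignment of independent uniform reals from $[0,1]$ to the vertices of $\mathbb{Z}^d$ is such that $\mathcal A(\mathcal D)$ is a $\Pi$-coloring for all $q$-toasts $\mathcal D$ simultaneously.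
   Formalization: In both classes the q-toasts are additionally required to have any two pieces nested or disjoint; conditions (i)-(ii) do not imply this, and without it the union of the maps A(E) need not be a partial map, so A(D) is undefined. *)

theory Defs
  imports "HOL-Probability.Probability"
begin

text \<open>
  The vertices of the grid are the elements of \<open>int ^ 'd\<close>, so the dimension is \<open>CARD('d) \<ge> 1\<close>.
  The edge labelled \<open>i\<close> leaving \<open>x\<close> goes to \<open>x + axis i 1\<close>.
\<close>

section \<open>The grid\<close>

definition grid_adj :: "((int ^ 'd) \<times> (int ^ 'd)) set" where
  "grid_adj = {(x, y). \<exists>i. y = x + axis i 1 \<or> x = y + axis i 1}"

definition grid_dist :: "int ^ 'd \<Rightarrow> int ^ 'd \<Rightarrow> nat" where
  "grid_dist x y = (LEAST n. (x, y) \<in> grid_adj ^^ n)"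

definition grid_ball :: "int ^ 'd \<Rightarrow> nat \<Rightarrow> (int ^ 'd) set" where
  "grid_ball v t = {x. grid_dist v x \<le> t}"

definition grid_connected :: "(int ^ 'd) set \<Rightarrow> bool" where
  "grid_connected A \<longleftrightarrow> A \<noteq> {} \<and> (\<forall>x\<in>A. \<forall>y\<in>A. (x, y) \<in> (grid_adj \<inter> A \<times> A)\<^sup>*)"

definition grid_boundary :: "(int ^ 'd) set \<Rightarrow> (int ^ 'd) set" where
  "grid_boundary D = {x \<in> D. \<exists>y. y \<notin> D \<and> (x, y) \<in> grid_adj}"

text \<open>Isomorphisms of induced subgraphs; they preserve orientation and label of every edge.\<close>

definition grid_iso :: "(int ^ 'd) set \<Rightarrow> (int ^ 'd) set \<Rightarrow> (int ^ 'd \<Rightarrow> int ^ 'd) \<Rightarrow> bool" where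
  "grid_iso A B \<phi> \<longleftrightarrow> bij_betw \<phi> A B \<and>
     (\<forall>x\<in>A. \<forall>y\<in>A. \<forall>i. y = x + axis i 1 \<longleftrightarrow> \<phi> y = \<phi> x + axis i 1)"


section \<open>Locally checkable problems\<close>

text \<open>
  A rooted labelled grid of radius \<open>t\<close> is given by a labelling \<open>p\<close>, of which only the values on
  \<open>grid_ball 0 t\<close> matter; its root is \<open>0\<close>. A set of isomorphism types is given by a set of such
  representatives: a neighborhood belongs to it if it is isomorphic to one of them.
\<close>

record ('i, 'o, 'd) lcl =
  sigma_in :: "'i set"
  sigma_out :: "'o set"
  radius :: nat
  patterns :: "(int ^ 'd \<Rightarrow> 'i \<times> 'o) set"

definition is_lcl :: "('i, 'o, 'd::finite) lcl \<Rightarrow> bool" where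
  "is_lcl L \<longleftrightarrow> finite (sigma_in L) \<and> finite (sigma_out L) \<and>
     (\<forall>p\<in>patterns L. \<forall>x\<in>grid_ball 0 (radius L). p x \<in> sigma_in L \<times> sigma_out L)"

definition is_coloring ::
  "('i, 'o, 'd::finite) lcl \<Rightarrow> (int ^ 'd \<Rightarrow> 'i) \<Rightarrow> (int ^ 'd \<Rightarrow> 'o) \<Rightarrow> bool" where
  "is_coloring L \<sigma> f \<longleftrightarrow>
     range \<sigma> \<subseteq> sigma_in L \<and> range f \<subseteq> sigma_out L \<and>
     (\<forall>v. \<exists>p\<in>patterns L. \<exists>\<phi>.
        grid_iso (grid_ball v (radius L)) (grid_ball 0 (radius L)) \<phi> \<and> \<phi> v = 0 \<and>
        (\<forall>x\<in>grid_ball v (radius L). p (\<phi> x) = (\<sigma> x, f x)))"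


section \<open>Toasts\<close>

definition toast :: "nat \<Rightarrow> (int ^ 'd) set set \<Rightarrow> bool" where
  "toast q \<D> \<longleftrightarrow>
     (\<forall>D\<in>\<D>. finite D \<and> grid_connected D) \<and>
     (\<forall>g h. \<exists>D\<in>\<D>. g \<in> D \<and> h \<in> D) \<and>
     (\<forall>D\<in>\<D>. \<forall>E\<in>\<D>.
        (\<exists>x\<in>grid_boundary D. \<exists>y\<in>grid_boundary E. grid_dist x y \<le> q) \<longrightarrow> D = E)"

text \<open>
  The recursive evaluation of an algorithm along a toast takes unions of the partial maps obtained
  on smaller pieces, and so presupposes that pieces which meet are nested. In dimension at least 2
  this does not follow from the conditions above, because a piece may have holes: if \<open>E\<close> is a large
  box with a large hole and \<open>D\<close> is a box that fills the hole and overlaps \<open>E\<close> around it, then the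
  boundaries of \<open>D\<close> and \<open>E\<close> are far apart, but neither piece contains the other, and the maps
  produced on \<open>D\<close> and \<open>E\<close> need not agree on \<open>D \<inter> E\<close>. Toasts are therefore required to be noncrossing
  wherever algorithms are evaluated on them.
\<close>

definition noncrossing :: "'a set set \<Rightarrow> bool" where
  "noncrossing \<D> \<longleftrightarrow> (\<forall>D\<in>\<D>. \<forall>E\<in>\<D>. D \<subseteq> E \<or> E \<subseteq> D \<or> D \<inter> E = {})"


section \<open>Evaluation along a toast\<close>

text \<open>The partial map whose graph is the union of the graphs, for pairwise compatible maps.\<close>

definition map_Union :: "('a \<rightharpoonup> 'b) set \<Rightarrow> ('a \<rightharpoonup> 'b)" where
  "map_Union M = (\<lambda>x. if \<exists>m\<in>M. x \<in> dom m then Some (THE y. \<exists>m\<in>M. m x = Some y) else None)"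

text \<open>
  Here \<open>F A c\<close> is the output of an algorithm on \<open>(A, c)\<close>, the labels of the vertices being fixed.
  Pieces are finite; the value on an infinite set is irrelevant.
\<close>

function toast_eval ::
  "((int ^ 'd) set \<Rightarrow> (int ^ 'd \<rightharpoonup> 'o) \<Rightarrow> (int ^ 'd \<rightharpoonup> 'o)) \<Rightarrow> (int ^ 'd) set set \<Rightarrow>
   (int ^ 'd) set \<Rightarrow> (int ^ 'd \<rightharpoonup> 'o)" where
  "toast_eval F \<D> D =
     (if finite D then F D (map_Union (toast_eval F \<D> ` {E \<in> \<D>. E \<subset> D})) else Map.empty)"
  by auto
termination
  by (relation "Wellfounded.measure (\<lambda>(F, \<D>, D). card D)") (auto intro: psubset_card_mono)

declare toast_eval.simps [simp del]

definition toast_output ::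
  "((int ^ 'd) set \<Rightarrow> (int ^ 'd \<rightharpoonup> 'o) \<Rightarrow> (int ^ 'd \<rightharpoonup> 'o)) \<Rightarrow> (int ^ 'd) set set \<Rightarrow>
   (int ^ 'd \<rightharpoonup> 'o)" where
  "toast_output F \<D> = map_Union (toast_eval F \<D> ` \<D>)"

definition solves_on ::
  "('i, 'o, 'd::finite) lcl \<Rightarrow> (int ^ 'd \<Rightarrow> 'i) \<Rightarrow>
   ((int ^ 'd) set \<Rightarrow> (int ^ 'd \<rightharpoonup> 'o) \<Rightarrow> (int ^ 'd \<rightharpoonup> 'o)) \<Rightarrow> (int ^ 'd) set set \<Rightarrow> bool" where
  "solves_on L \<sigma> F \<D> \<longleftrightarrow> (\<exists>f. toast_output F \<D> = (\<lambda>x. Some (f x)) \<and> is_coloring L \<sigma> f)"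


section \<open>Spontaneous algorithms\<close>

text \<open>
  Labellings of \<open>A\<close> are given by total functions, of which only the values on \<open>A\<close> matter: the case
  \<open>\<phi> = id\<close> of the invariance conditions below says that the output does not depend on other values.
\<close>

definition toast_input ::
  "('i, 'o, 'd::finite) lcl \<Rightarrow> (int ^ 'd) set \<Rightarrow> (int ^ 'd \<Rightarrow> 'i) \<Rightarrow> (int ^ 'd \<rightharpoonup> 'o) \<Rightarrow> bool" where
  "toast_input L A \<sigma> c \<longleftrightarrow>
     finite A \<and> grid_connected A \<and> \<sigma> ` A \<subseteq> sigma_in L \<and> dom c \<subseteq> A \<and> ran c \<subseteq> sigma_out L"

definition toast_extension ::
  "('i, 'o, 'd::finite) lcl \<Rightarrow> (int ^ 'd) set \<Rightarrow> (int ^ 'd \<rightharpoonup> 'o) \<Rightarrow> (int ^ 'd \<rightharpoonup> 'o) \<Rightarrow> bool" where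
  "toast_extension L A c e \<longleftrightarrow> dom e = A \<and> ran e \<subseteq> sigma_out L \<and> c \<subseteq>\<^sub>m e"

definition toast_algorithm ::
  "('i, 'o, 'd::finite) lcl \<Rightarrow>
   ((int ^ 'd \<Rightarrow> 'i) \<Rightarrow> (int ^ 'd) set \<Rightarrow> (int ^ 'd \<rightharpoonup> 'o) \<Rightarrow> (int ^ 'd \<rightharpoonup> 'o)) \<Rightarrow> bool" where
  "toast_algorithm L \<A> \<longleftrightarrow>
     (\<forall>A \<sigma> c. toast_input L A \<sigma> c \<longrightarrow> toast_extension L A c (\<A> \<sigma> A c)) \<and>
     (\<forall>A \<sigma> c B \<sigma>' c' \<phi>.
        toast_input L A \<sigma> c \<and> toast_input L B \<sigma>' c' \<and> grid_iso A B \<phi> \<and>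
        (\<forall>x\<in>A. \<sigma>' (\<phi> x) = \<sigma> x \<and> c' (\<phi> x) = c x) \<longrightarrow>
        (\<forall>x\<in>A. \<A> \<sigma>' B c' (\<phi> x) = \<A> \<sigma> A c x))"

definition unit_uniform :: "real measure" where
  "unit_uniform = restrict_space lborel {0..1}"

definition randomized_toast_algorithm ::
  "('i, 'o, 'd::finite) lcl \<Rightarrow>
   ((int ^ 'd \<Rightarrow> 'i) \<Rightarrow> (int ^ 'd \<Rightarrow> real) \<Rightarrow> (int ^ 'd) set \<Rightarrow> (int ^ 'd \<rightharpoonup> 'o) \<Rightarrow>
    (int ^ 'd \<rightharpoonup> 'o)) \<Rightarrow> bool" where
  "randomized_toast_algorithm L \<A> \<longleftrightarrow>
     (\<forall>A \<sigma> \<omega> c. toast_input L A \<sigma> c \<and> \<omega> ` A \<subseteq> {0..1} \<longrightarrow>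
        toast_extension L A c (\<A> \<sigma> \<omega> A c)) \<and>
     (\<forall>A \<sigma> \<omega> c B \<sigma>' \<omega>' c' \<phi>.
        toast_input L A \<sigma> c \<and> \<omega> ` A \<subseteq> {0..1} \<and>
        toast_input L B \<sigma>' c' \<and> \<omega>' ` B \<subseteq> {0..1} \<and> grid_iso A B \<phi> \<and>
        (\<forall>x\<in>A. \<sigma>' (\<phi> x) = \<sigma> x \<and> \<omega>' (\<phi> x) = \<omega> x \<and> c' (\<phi> x) = c x) \<longrightarrow>
        (\<forall>x\<in>A. \<A> \<sigma>' \<omega>' B c' (\<phi> x) = \<A> \<sigma> \<omega> A c x)) \<and>
     (\<forall>A \<sigma> c. toast_input L A \<sigma> c \<longrightarrow>
        (\<lambda>\<omega>. \<A> \<sigma> \<omega> A c) \<in> measurable (PiM A (\<lambda>_. unit_uniform)) (count_space UNIV))"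


section \<open>The classes\<close>

definition TOAST :: "('i, 'o, 'd::finite) lcl set" where
  "TOAST = {L. \<exists>q>0. \<exists>\<A>. toast_algorithm L \<A> \<and>
     (\<forall>\<sigma>. range \<sigma> \<subseteq> sigma_in L \<longrightarrow>
        (\<forall>\<D>. toast q \<D> \<and> noncrossing \<D> \<longrightarrow> solves_on L \<sigma> (\<A> \<sigma>) \<D>))}"

definition RTOAST :: "('i, 'o, 'd::finite) lcl set" where
  "RTOAST = {L. \<exists>q>0. \<exists>\<A>. randomized_toast_algorithm L \<A> \<and>
     (\<forall>\<sigma>. range \<sigma> \<subseteq> sigma_in L \<longrightarrow>
        (AE \<omega> in PiM UNIV (\<lambda>_. unit_uniform).
           \<forall>\<D>. toast q \<D> \<and> noncrossing \<D> \<longrightarrow> solves_on L \<sigma> (\<A> \<sigma> \<omega>) \<D>))}"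

end

theory Submission
  imports Defs
begin

text \<open>
  Fix a randomized algorithm that succeeds on \<open>q\<close>-toasts. Call an output on a piece \<open>A\<close> nice if there
  is some finite \<open>q\<close>-toast of subsets of \<open>A\<close>, with \<open>A\<close> on top, along which the randomized algorithm
  produces this output with positive probability. The deterministic algorithm extends its input to a
  nice output whenever it can. It always can: the maximal proper subpieces of a piece are disjoint,
  so by independence their nice outputs occur simultaneously with positive probability along the
  union of the witnessing toasts, and one of the finitely many extensions then has positive
  probability. If the deterministic output is nice on a piece \<open>D\<close> that contains the neighborhood of a
  vertex, replace the part of the given toast inside \<open>D\<close> by the witnessing toast. On the resulting
  toast the randomized algorithm almost surely succeeds, and with positive probability it agrees
  on \<open>D\<close> with the deterministic output, which is therefore correct at that vertex.
\<close>

section \<open>Unions of compatible partial maps\<close>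

text \<open>The description operator in \<open>map_Union\<close> singles out a value at a point only
  if all maps defined there agree. This condition makes the union a common extension of its
  members.\<close>

definition compatible_maps :: "('a \<rightharpoonup> 'b) set \<Rightarrow> bool" where
  "compatible_maps M \<longleftrightarrow> (\<forall>m\<in>M. \<forall>m'\<in>M. \<forall>x\<in>dom m \<inter> dom m'. m x = m' x)"

lemma map_Union_apply:
  assumes "compatible_maps M" "m \<in> M" "x \<in> dom m"
  shows "map_Union M x = m x"
proof -
  obtain y where y: "m x = Some y"
    using assms by auto
  have "(THE y. \<exists>m\<in>M. m x = Some y) = y"
  proof (rule the_equality)
    show "\<exists>m\<in>M. m x = Some y"
      using assms(2) y by blast
    fix z assume "\<exists>m\<in>M. m x = Some z"
    then obtain m' where "m' \<in> M" "m' x = Some z"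
      by blast
    then show "z = y"
      using assms y unfolding compatible_maps_def by (metis IntI domI option.inject)
  qed
  then show ?thesis
    using assms y by (auto simp: map_Union_def)
qed

lemma dom_map_Union: "dom (map_Union M) = (\<Union>m\<in>M. dom m)"
  by (auto simp: map_Union_def dom_def)

lemma ran_map_Union:
  assumes "compatible_maps M" "\<And>m. m \<in> M \<Longrightarrow> ran m \<subseteq> B"
  shows "ran (map_Union M) \<subseteq> B"
proof
  fix y assume "y \<in> ran (map_Union M)"
  then obtain x where x: "map_Union M x = Some y"
    by (auto simp: ran_def)
  then obtain m where m: "m \<in> M" "x \<in> dom m"
    using dom_map_Union[of M] by blast
  then have "m x = Some y"
    using map_Union_apply[OF assms(1) m] x by simp
  then show "y \<in> B"
    using assms(2)[OF m(1)] by (auto intro: ranI)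
qed

lemma map_Union_comp: "map_Union ((\<lambda>m. m \<circ> h) ` M) = map_Union M \<circ> h"
  by (simp add: map_Union_def fun_eq_iff dom_def)


section \<open>Evaluation along a family of pieces\<close>

text \<open>The extension clause of an algorithm after the input labels and the random labels have
  been fixed. In this form the facts on evaluation apply to randomized and deterministic algorithms
  alike.\<close>

definition extending ::
  "'o set \<Rightarrow> ('a set \<Rightarrow> ('a \<rightharpoonup> 'o) \<Rightarrow> ('a \<rightharpoonup> 'o)) \<Rightarrow> 'a set set \<Rightarrow> bool" where
  "extending S F H \<longleftrightarrow> (\<forall>B\<in>H. \<forall>c. dom c \<subseteq> B \<and> ran c \<subseteq> S \<longrightarrow>
     dom (F B c) = B \<and> ran (F B c) \<subseteq> S \<and> c \<subseteq>\<^sub>m F B c)"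

definition sub_eval ::
  "((int ^ 'd) set \<Rightarrow> (int ^ 'd \<rightharpoonup> 'o) \<Rightarrow> (int ^ 'd \<rightharpoonup> 'o)) \<Rightarrow> (int ^ 'd) set set \<Rightarrow>
   (int ^ 'd) set \<Rightarrow> (int ^ 'd \<rightharpoonup> 'o)" where
  "sub_eval F H D = map_Union (toast_eval F H ` {E \<in> H. E \<subset> D})"

lemma toast_eval_finite: "finite D \<Longrightarrow> toast_eval F H D = F D (sub_eval F H D)"
  by (subst toast_eval.simps) (simp add: sub_eval_def)

text \<open>The claims depend on each other and go through one induction on \<open>card D\<close>:
  the input on \<open>D\<close> is well behaved only if the outputs on smaller pieces are
  compatible, and compatibility comes from monotonicity at those smaller pieces.\<close>

lemma toast_eval_extends:
  assumes nc: "noncrossing H" and fin': "\<forall>B\<in>H. finite B" and ext: "extending S F H"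
    and D: "D \<in> H"
  shows "dom (toast_eval F H D) = D" (is ?dom)
    and "ran (toast_eval F H D) \<subseteq> S" (is ?ran)
    and "dom (sub_eval F H D) \<subseteq> D" (is ?sdom)
    and "ran (sub_eval F H D) \<subseteq> S" (is ?sran)
    and "\<And>E. E \<in> H \<Longrightarrow> E \<subset> D \<Longrightarrow> toast_eval F H E \<subseteq>\<^sub>m sub_eval F H D" (is "\<And>E. _ \<Longrightarrow> _ \<Longrightarrow> ?sub E")
    and "\<And>E. E \<in> H \<Longrightarrow> E \<subset> D \<Longrightarrow> toast_eval F H E \<subseteq>\<^sub>m toast_eval F H D" (is "\<And>E. _ \<Longrightarrow> _ \<Longrightarrow> ?mono E")
proof -
  note fin = bspec[OF fin']
  have "?dom \<and> ?ran \<and> ?sdom \<and> ?sran \<and> (\<forall>E\<in>H. E \<subset> D \<longrightarrow> ?sub E) \<and> (\<forall>E\<in>H. E \<subset> D \<longrightarrow> ?mono E)"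
    using D
  proof (induction "card D" arbitrary: D rule: less_induct)
    case (less D)
    let ?e = "toast_eval F H" and ?M = "toast_eval F H ` {E \<in> H. E \<subset> D}"
    have IH: "dom (?e E) = E" "ran (?e E) \<subseteq> S" "\<And>G. G \<in> H \<Longrightarrow> G \<subset> E \<Longrightarrow> ?e G \<subseteq>\<^sub>m ?e E"
      if "E \<in> H" "E \<subset> D" for E
    proof -
      have "card E < card D"
        using that fin[OF less.prems] by (simp add: psubset_card_mono)
      note less.hyps[OF this \<open>E \<in> H\<close>]
      then show "dom (?e E) = E" "ran (?e E) \<subseteq> S" "\<And>G. G \<in> H \<Longrightarrow> G \<subset> E \<Longrightarrow> ?e G \<subseteq>\<^sub>m ?e E"
        by simp_all
    qed
    \<comment> \<open>Overlapping pieces are nested because the family is noncrossing, and the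
      output on the larger one extends that on the smaller one.\<close>
    have agree: "?e E x = ?e G x"
      if E: "E \<in> H" "E \<subset> D" and G: "G \<in> H" "G \<subset> D" and x: "x \<in> E" "x \<in> G" for E G x
    proof -
      consider "E = G" | "E \<subset> G" | "G \<subset> E"
        using nc E G x unfolding noncrossing_def by blast
      then show ?thesis
      proof cases
        case 2
        then show ?thesis using IH(3)[OF G E(1)] IH(1)[OF E] x by (auto simp: map_le_def)
      next
        case 3
        then show ?thesis using IH(3)[OF E G(1)] IH(1)[OF G] x by (auto simp: map_le_def)
      qed simp
    qed
    have comp: "compatible_maps ?M"
      unfolding compatible_maps_def using IH(1) by (auto intro!: agree)
    have sdom: "dom (sub_eval F H D) \<subseteq> D"
      using IH(1) by (auto simp: sub_eval_def dom_map_Union)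
    have sran: "ran (sub_eval F H D) \<subseteq> S"
      unfolding sub_eval_def using IH(2) by (intro ran_map_Union[OF comp]) auto
    have ssub: "?e E \<subseteq>\<^sub>m sub_eval F H D" if "E \<in> H" "E \<subset> D" for E
      unfolding map_le_def sub_eval_def
      using map_Union_apply[OF comp, of "?e E"] that by simp
    have eq: "?e D = F D (sub_eval F H D)"
      using fin[OF less.prems] by (rule toast_eval_finite)
    have F: "dom (?e D) = D" "ran (?e D) \<subseteq> S" "sub_eval F H D \<subseteq>\<^sub>m ?e D"
      using ext[unfolded extending_def, rule_format, OF less.prems conjI[OF sdom sran]]
      unfolding eq by simp_all
    show ?case
      using F sdom sran ssub map_le_trans[OF ssub F(3)] by simp
  qed
  then show ?dom ?ran ?sdom ?sran
    "\<And>E. E \<in> H \<Longrightarrow> E \<subset> D \<Longrightarrow> ?sub E" "\<And>E. E \<in> H \<Longrightarrow> E \<subset> D \<Longrightarrow> ?mono E"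
    by simp_all
qed

lemma dom_sub_eval:
  assumes "noncrossing H" "\<forall>B\<in>H. finite B" "extending S F H"
  shows "dom (sub_eval F H D) = \<Union>{E \<in> H. E \<subset> D}"
  using toast_eval_extends(1)[OF assms] by (auto simp: sub_eval_def dom_map_Union)

lemma toast_output_apply:
  assumes nc: "noncrossing H" and fin': "\<forall>B\<in>H. finite B" and ext: "extending S F H"
    and D: "D \<in> H" "x \<in> D"
  shows "toast_output F H x = toast_eval F H D x"
proof -
  have ev: "dom (toast_eval F H E) = E" "G \<in> H \<Longrightarrow> G \<subset> E \<Longrightarrow> toast_eval F H G \<subseteq>\<^sub>m toast_eval F H E"
    if "E \<in> H" for E G
    using toast_eval_extends(1,6)[OF nc fin' ext that] by simp_all
  have agree: "toast_eval F H E x = toast_eval F H G x"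
    if EG: "E \<in> H" "G \<in> H" "x \<in> E" "x \<in> G" for E G x
  proof -
    consider "E = G" | "E \<subset> G" | "G \<subset> E"
      using nc EG unfolding noncrossing_def by blast
    then show ?thesis
    proof cases
      case 2
      then show ?thesis using ev(2)[of G E] ev(1)[of E] EG by (simp add: map_le_def)
    next
      case 3
      then show ?thesis using ev(2)[of E G] ev(1)[of G] EG by (simp add: map_le_def)
    qed simp
  qed
  have "compatible_maps (toast_eval F H ` H)"
    unfolding compatible_maps_def using ev(1) by (auto intro!: agree)
  moreover have "x \<in> dom (toast_eval F H D)"
    using D ev(1) by simp
  ultimately show ?thesis
    unfolding toast_output_def using D(1) by (simp add: map_Union_apply)
qed

section \<open>Translation of evaluations\<close>

lemma inj_shift: "inj ((+) (v :: int ^ 'd))"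
  by simp

lemma shift_subset_iff: "(+) (v :: int ^ 'd) ` A \<subseteq> (+) v ` B \<longleftrightarrow> A \<subseteq> B"
  by (simp add: inj_image_subset_iff)

text \<open>The recursion on a piece inside \<open>A\<close> visits only pieces inside
  \<open>A\<close>, so the two families have to correspond only there. By
  \<open>toast_eval_extends\<close> it feeds \<open>F\<close> only inputs with domain in the piece
  and values in \<open>S\<close>, so \<open>F'\<close> has to match \<open>F\<close> only on these.
  The case \<open>v = 0\<close> expresses locality.\<close>

lemma toast_eval_transport:
  fixes v :: "int ^ 'd"
  assumes nc: "noncrossing H" and fin': "\<forall>B\<in>H. finite B" and ext: "extending S F H"
    and H': "{G \<in> H'. G \<subseteq> (+) v ` A} = (`) ((+) v) ` {G \<in> H. G \<subseteq> A}"
    and F': "\<And>B c. B \<in> H \<Longrightarrow> B \<subseteq> A \<Longrightarrow> dom c \<subseteq> B \<Longrightarrow> ran c \<subseteq> S \<Longrightarrow>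
      F' ((+) v ` B) (\<lambda>x. c (x - v)) = (\<lambda>x. F B c (x - v))"
    and D: "D \<in> H" "D \<subseteq> A"
  shows "toast_eval F' H' ((+) v ` D) = (\<lambda>x. toast_eval F H D (x - v))"
  using D
proof (induction "card D" arbitrary: D rule: less_induct)
  case (less D)
  note fin = bspec[OF fin']
  have psub: "(+) v ` G \<subset> (+) v ` D \<longleftrightarrow> G \<subset> D" for G
    by (simp add: psubset_eq shift_subset_iff inj_image_eq_iff)
  \<comment> \<open>Since \<open>D\<close> lies in \<open>A\<close>, the inner restriction changes
    nothing, but it brings the family into the form to which the assumption \<open>H'\<close>
    applies.\<close>
  have "{G \<in> H'. G \<subset> (+) v ` D} = {G \<in> {G \<in> H'. G \<subseteq> (+) v ` A}. G \<subset> (+) v ` D}"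
    using less.prems by blast
  also have "\<dots> = (`) ((+) v) ` {G \<in> H. G \<subset> D}"
    unfolding H'
  proof (intro set_eqI iffI)
    fix X assume "X \<in> {G \<in> (`) ((+) v) ` {G \<in> H. G \<subseteq> A}. G \<subset> (+) v ` D}"
    then obtain G where G: "X = (+) v ` G" "G \<in> H" "X \<subset> (+) v ` D"
      by blast
    then have "G \<subset> D"
      using psub[of G] by simp
    with G show "X \<in> (`) ((+) v) ` {G \<in> H. G \<subset> D}"
      by blast
  next
    fix X assume "X \<in> (`) ((+) v) ` {G \<in> H. G \<subset> D}"
    then obtain G where "X = (+) v ` G" "G \<in> H" "G \<subset> D"
      by blast
    then show "X \<in> {G \<in> (`) ((+) v) ` {G \<in> H. G \<subseteq> A}. G \<subset> (+) v ` D}"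
      using psub[of G] less.prems(2) by blast
  qed
  finally have sub: "{G \<in> H'. G \<subset> (+) v ` D} = (`) ((+) v) ` {G \<in> H. G \<subset> D}" .
  have IH: "toast_eval F' H' ((+) v ` G) = toast_eval F H G \<circ> (\<lambda>x. x - v)" if "G \<in> H" "G \<subset> D" for G
    using less.hyps[of G] that less.prems fin[of D] by (auto simp: psubset_card_mono fun_eq_iff)
  have "sub_eval F' H' ((+) v ` D) = sub_eval F H D \<circ> (\<lambda>x. x - v)"
    unfolding sub_eval_def sub using IH
    by (subst map_Union_comp[symmetric]) (auto simp: image_image intro!: arg_cong[where f = map_Union] image_cong)
  then have "toast_eval F' H' ((+) v ` D) = F' ((+) v ` D) (\<lambda>x. sub_eval F H D (x - v))"
    using less.prems fin[of D] by (simp add: toast_eval_finite comp_def)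
  also have "\<dots> = (\<lambda>x. F D (sub_eval F H D) (x - v))"
    using toast_eval_extends(3,4)[OF nc fin' ext less.prems(1)] less.prems by (intro F') auto
  finally show ?case
    using less.prems fin[of D] by (simp add: toast_eval_finite)
qed


section \<open>Boundaries and gluing of toasts\<close>

lemma grid_adj_sym: "(x, y) \<in> grid_adj \<longleftrightarrow> (y, x) \<in> grid_adj"
  by (auto simp: grid_adj_def)

lemma grid_adj_relpow_sym: "(x, y) \<in> grid_adj ^^ n \<longleftrightarrow> (y, x) \<in> grid_adj ^^ n"
proof -
  have "(x, y) \<in> grid_adj ^^ n \<Longrightarrow> (y, x) \<in> grid_adj ^^ n" for x y :: "int ^ 'd"
  proof (induction n arbitrary: y)
    case (Suc n)
    then obtain z where "(x, z) \<in> grid_adj ^^ n" "(z, y) \<in> grid_adj"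
      by auto
    then show ?case
      using Suc.IH grid_adj_sym relpow_Suc_I2 by metis
  qed simp
  then show ?thesis by blast
qed

lemma grid_dist_sym: "grid_dist x y = grid_dist y x"
  by (simp add: grid_dist_def grid_adj_relpow_sym[of x y])

lemma grid_adj_shift: "(v + x, v + y) \<in> grid_adj \<longleftrightarrow> (x, y) \<in> grid_adj"
  by (simp add: grid_adj_def add.assoc)

lemma grid_adj_relpow_shift: "(v + x, v + y) \<in> grid_adj ^^ n \<longleftrightarrow> (x, y) \<in> grid_adj ^^ n"
proof (induction n arbitrary: y)
  case (Suc n)
  show ?case
  proof
    assume "(v + x, v + y) \<in> grid_adj ^^ Suc n"
    then obtain z where "(v + x, v + (z - v)) \<in> grid_adj ^^ n" "(v + (z - v), v + y) \<in> grid_adj"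
      by auto
    then have "(x, z - v) \<in> grid_adj ^^ n" "(z - v, y) \<in> grid_adj"
      using Suc.IH[of "z - v"] grid_adj_shift[of v "z - v" y] by blast+
    then show "(x, y) \<in> grid_adj ^^ Suc n"
      by auto
  next
    assume "(x, y) \<in> grid_adj ^^ Suc n"
    then obtain z where "(x, z) \<in> grid_adj ^^ n" "(z, y) \<in> grid_adj"
      by auto
    then have "(v + x, v + z) \<in> grid_adj ^^ n" "(v + z, v + y) \<in> grid_adj"
      using Suc.IH[of z] grid_adj_shift[of v z y] by blast+
    then show "(v + x, v + y) \<in> grid_adj ^^ Suc n"
      by auto
  qed
qed simp

lemma grid_dist_shift: "grid_dist (v + x) (v + y) = grid_dist x y"
  by (simp add: grid_dist_def grid_adj_relpow_shift)

lemma grid_boundary_shift: "grid_boundary ((+) v ` D) = (+) v ` grid_boundary D"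
proof -
  have "v + x \<in> grid_boundary ((+) v ` D) \<longleftrightarrow> x \<in> grid_boundary D" for x
  proof -
    have "(\<exists>y. P y) \<longleftrightarrow> (\<exists>y. P (v + y))" for P
      by (metis add_diff_cancel_left' add_diff_eq)
    then have "(\<exists>y. y \<notin> (+) v ` D \<and> (v + x, y) \<in> grid_adj) \<longleftrightarrow>
        (\<exists>y. v + y \<notin> (+) v ` D \<and> (v + x, v + y) \<in> grid_adj)" .
    then show ?thesis
      by (simp add: grid_boundary_def grid_adj_shift inj_image_mem_iff)
  qed
  note shift = this
  show ?thesis
  proof (rule set_eqI)
    fix y
    have "y = v + (y - v)"
      by simp
    then show "y \<in> grid_boundary ((+) v ` D) \<longleftrightarrow> y \<in> (+) v ` grid_boundary D"
      using shift[of "y - v"] inj_image_mem_iff[OF inj_shift] by metis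
  qed
qed

lemma grid_connected_shift:
  assumes "grid_connected A"
  shows "grid_connected ((+) v ` A)"
proof -
  have "(v + x, v + y) \<in> (grid_adj \<inter> ((+) v ` A) \<times> ((+) v ` A))\<^sup>*"
    if "(x, y) \<in> (grid_adj \<inter> A \<times> A)\<^sup>*" for x y
    using that
  proof induction
    case (step y z)
    then have "(v + y, v + z) \<in> grid_adj \<inter> ((+) v ` A) \<times> ((+) v ` A)"
      by (auto simp: grid_adj_shift)
    then show ?case
      using step.IH by (rule rtrancl_into_rtrancl[rotated])
  qed simp
  then show ?thesis
    using assms unfolding grid_connected_def by auto
qed

text \<open>The vertex just before the path first leaves \<open>D\<close> lies on the boundary, and
  the rest of the path is no longer than the whole.\<close>

lemma boundary_crossing:
  assumes "(x, y) \<in> grid_adj ^^ n" "x \<in> D" "y \<notin> D"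
  shows "\<exists>z\<in>grid_boundary D. \<exists>m\<le>n. (z, y) \<in> grid_adj ^^ m"
  using assms
proof (induction n arbitrary: x)
  case (Suc n)
  then obtain x' where x': "(x, x') \<in> grid_adj" "(x', y) \<in> grid_adj ^^ n"
    using relpow_Suc_E2 by metis
  show ?case
  proof (cases "x' \<in> D")
    case True
    then show ?thesis
      using Suc x' le_Suc_eq by metis
  next
    case False
    then have "x \<in> grid_boundary D"
      using Suc.prems x' by (auto simp: grid_boundary_def)
    then show ?thesis
      using Suc.prems by blast
  qed
qed simp

section \<open>Partial toasts and separation of boundaries\<close>

definition boundaries_close :: "nat \<Rightarrow> (int ^ 'd) set \<Rightarrow> (int ^ 'd) set \<Rightarrow> bool" where
  "boundaries_close q D E \<longleftrightarrow> (\<exists>x\<in>grid_boundary D. \<exists>y\<in>grid_boundary E. grid_dist x y \<le> q)"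

definition nested_or_disjoint :: "'a set \<Rightarrow> 'a set \<Rightarrow> bool" where
  "nested_or_disjoint D E \<longleftrightarrow> D \<subseteq> E \<or> E \<subseteq> D \<or> D \<inter> E = {}"

text \<open>A noncrossing toast without the covering condition. This is what survives passing to a
  subfamily, and it makes sense for finite families.\<close>

definition partial_toast :: "nat \<Rightarrow> (int ^ 'd) set set \<Rightarrow> bool" where
  "partial_toast q H \<longleftrightarrow> (\<forall>D\<in>H. finite D \<and> grid_connected D) \<and>
     (\<forall>D\<in>H. \<forall>E\<in>H. nested_or_disjoint D E \<and> (boundaries_close q D E \<longrightarrow> D = E))"

lemma toast_noncrossing_iff:
  "toast q \<D> \<and> noncrossing \<D> \<longleftrightarrow> partial_toast q \<D> \<and> (\<forall>g h. \<exists>D\<in>\<D>. g \<in> D \<and> h \<in> D)"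
  unfolding toast_def noncrossing_def partial_toast_def boundaries_close_def nested_or_disjoint_def
    ball_conj_distrib
  by (rule iffI, (elim conjE, intro conjI, assumption+)+)

lemma partial_toastD:
  assumes "partial_toast q H"
  shows "noncrossing H" "\<And>B. B \<in> H \<Longrightarrow> finite B" "\<And>B. B \<in> H \<Longrightarrow> grid_connected B"
    "\<And>B. B \<in> H \<Longrightarrow> B \<noteq> {}" "\<forall>B\<in>H. finite B"
proof -
  show "noncrossing H"
    using assms by (simp add: partial_toast_def noncrossing_def nested_or_disjoint_def)
  show "finite B" "grid_connected B" if "B \<in> H" for B
    using assms that by (simp_all add: partial_toast_def)
  then show "B \<noteq> {}" if "B \<in> H" for B
    using that by (auto simp: grid_connected_def)
  show "\<forall>B\<in>H. finite B"
    using assms by (simp add: partial_toast_def)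
qed

lemma partial_toast_subset: "partial_toast q H \<Longrightarrow> K \<subseteq> H \<Longrightarrow> partial_toast q K"
  unfolding partial_toast_def by auto

lemma boundaries_close_sym:
  fixes D E :: "(int ^ 'd) set"
  shows "boundaries_close q D E \<longleftrightarrow> boundaries_close q E D"
proof -
  have "boundaries_close q E D" if "boundaries_close q D E" for D E :: "(int ^ 'd) set"
  proof -
    obtain x y where "x \<in> grid_boundary D" "y \<in> grid_boundary E" "grid_dist x y \<le> q"
      using \<open>boundaries_close q D E\<close> unfolding boundaries_close_def by blast
    then show ?thesis
      unfolding boundaries_close_def using grid_dist_sym[of x y] by auto
  qed
  then show ?thesis by blast
qed

lemma nested_or_disjoint_sym: "nested_or_disjoint D E \<longleftrightarrow> nested_or_disjoint E D"
  by (auto simp: nested_or_disjoint_def)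

lemma partial_toast_shift:
  assumes "partial_toast q H"
  shows "partial_toast q ((`) ((+) v) ` H)"
proof -
  have "boundaries_close q ((+) v ` D) ((+) v ` E) \<longleftrightarrow> boundaries_close q D E" for D E
    by (simp add: boundaries_close_def grid_boundary_shift grid_dist_shift)
  moreover have "nested_or_disjoint ((+) v ` D) ((+) v ` E) \<longleftrightarrow> nested_or_disjoint D E" for D E
    unfolding nested_or_disjoint_def
    by (simp add: shift_subset_iff flip: image_Int[OF inj_shift])
  ultimately show ?thesis
    using assms by (simp add: partial_toast_def grid_connected_shift inj_image_eq_iff)
qed

text \<open>\<^const>\<open>grid_dist\<close> bounds the length of a path only if there is a path at all.\<close>

lemma toast_path:
  fixes \<D> :: "(int ^ 'd) set set" and x y :: "int ^ 'd"
  assumes "toast q \<D>"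
  shows "(x, y) \<in> grid_adj ^^ grid_dist x y"
proof -
  have "\<exists>D\<in>\<D>. x \<in> D \<and> y \<in> D" "\<forall>D\<in>\<D>. grid_connected D"
    using assms by (simp_all add: toast_def)
  then obtain D where "x \<in> D" "y \<in> D" "grid_connected D"
    by blast
  then have "(x, y) \<in> (grid_adj \<inter> D \<times> D)\<^sup>*"
    unfolding grid_connected_def by blast
  then have "(x, y) \<in> grid_adj\<^sup>*"
    using rtrancl_mono[of "grid_adj \<inter> D \<times> D" grid_adj] by blast
  then show ?thesis
    unfolding grid_dist_def using rtrancl_power LeastI_ex by metis
qed

text \<open>A shortest path from the boundary of \<open>G\<close> to that of \<open>E\<close> starts
  inside \<open>D\<close> and ends outside it. Where it first leaves \<open>D\<close> there is a
  boundary vertex of \<open>D\<close> at least as close to the end. The toast guarantees that such a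
  path exists.\<close>

lemma boundaries_close_mono:
  fixes \<D> :: "(int ^ 'd) set set" and D E G :: "(int ^ 'd) set"
  assumes "toast q' \<D>" and "boundaries_close q G E" "G \<subseteq> D" "grid_boundary E \<inter> D = {}"
  shows "boundaries_close q D E"
proof -
  obtain x y where xy: "x \<in> grid_boundary G" "y \<in> grid_boundary E" "grid_dist x y \<le> q"
    using assms unfolding boundaries_close_def by blast
  then have "x \<in> D" "y \<notin> D"
    using assms by (auto simp: grid_boundary_def)
  from boundary_crossing[OF toast_path[OF assms(1)] this]
  obtain z m where zm: "z \<in> grid_boundary D" "m \<le> grid_dist x y" "(z, y) \<in> grid_adj ^^ m"
    by blast
  then have "grid_dist z y \<le> m"
    unfolding grid_dist_def by (intro Least_le)
  then show ?thesis
    unfolding boundaries_close_def using xy zm by (meson le_trans)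
qed

text \<open>A boundary vertex of the larger set that lies in the smaller one is on the boundary of
  both, at distance 0 from itself.\<close>

lemma boundary_disjoint_of_subset:
  assumes "D \<subseteq> E" "\<not> boundaries_close q D E"
  shows "grid_boundary E \<inter> D = {}"
proof (rule ccontr)
  assume "grid_boundary E \<inter> D \<noteq> {}"
  then obtain y where y: "y \<in> grid_boundary E" "y \<in> D"
    by blast
  then have "y \<in> grid_boundary D"
    using assms(1) by (auto simp: grid_boundary_def)
  moreover have "grid_dist y y = 0"
    unfolding grid_dist_def by (rule Least_eq_0) simp
  ultimately show False
    using assms(2) y unfolding boundaries_close_def by force
qed

section \<open>Surgery on toasts\<close>

text \<open>A member \<open>E\<close> of \<open>\<C>\<close> is contained in itself and so is
  removed from \<open>\<D>\<close> with its subpieces; it has to be supplied again by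
  \<open>H E\<close>.\<close>

definition glue ::
  "(int ^ 'd) set set \<Rightarrow> (int ^ 'd) set set \<Rightarrow> ((int ^ 'd) set \<Rightarrow> (int ^ 'd) set set) \<Rightarrow>
   (int ^ 'd) set set" where
  "glue \<D> \<C> H = (\<Union>E\<in>\<C>. H E) \<union> {G \<in> \<D>. \<forall>E\<in>\<C>. \<not> G \<subseteq> E}"

text \<open>A short path from inside \<open>E\<close> to the boundary of a piece not inside
  \<open>E\<close> would cross the boundary of \<open>E\<close>, so the new pieces inherit their
  separation from \<open>\<D>\<close>. By the last claim, evaluating at \<open>E\<close> along the
  glued toast amounts to evaluating along \<open>H E\<close>.\<close>

lemma glue_toast:
  fixes \<D> :: "(int ^ 'd) set set"
  assumes toast: "toast q \<D>" "noncrossing \<D>" and \<C>: "\<C> \<subseteq> \<D>" "pairwise disjnt \<C>"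
    and H: "\<And>E. E \<in> \<C> \<Longrightarrow> partial_toast q (H E) \<and> E \<in> H E \<and> (\<forall>G\<in>H E. G \<subseteq> E)"
  shows "toast q (glue \<D> \<C> H)" "noncrossing (glue \<D> \<C> H)"
    and "\<And>E. E \<in> \<C> \<Longrightarrow> {G \<in> glue \<D> \<C> H. G \<subseteq> E} = H E"
proof -
  have \<D>: "partial_toast q \<D>" "\<And>g h. \<exists>D\<in>\<D>. g \<in> D \<and> h \<in> D"
    using toast toast_noncrossing_iff by blast+
  define ok where
    "ok D E \<longleftrightarrow> nested_or_disjoint D E \<and> (boundaries_close q D E \<longrightarrow> D = E)" for D E :: "(int ^ 'd) set"
  have ok_sym: "ok D E \<longleftrightarrow> ok E D" for D E
    unfolding ok_def using nested_or_disjoint_sym boundaries_close_sym by metis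
  have ok_\<D>: "ok D E" if "D \<in> \<D>" "E \<in> \<D>" for D E
    using \<D>(1) that unfolding ok_def partial_toast_def by blast
  \<comment> \<open>Either \<open>K\<close> properly contains \<open>E\<close> or is disjoint from
    it. In both cases its boundary avoids \<open>E\<close>, so closeness to \<open>G\<close> would
    give closeness to \<open>E\<close>.\<close>
  have mixed: "ok G K" if E: "E \<in> \<C>" "G \<in> H E" and K: "K \<in> \<D>" "\<not> K \<subseteq> E" for E G K
  proof -
    have *: "\<not> boundaries_close q E K" "E \<subseteq> K \<or> E \<inter> K = {}"
      using ok_\<D>[of E K] E K \<C> unfolding ok_def nested_or_disjoint_def by blast+
    have GE: "G \<subseteq> E"
      using H E by blast
    have "grid_boundary K \<inter> E = {}"
      using * boundary_disjoint_of_subset[of E K q] by (auto simp: grid_boundary_def)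
    then have "\<not> boundaries_close q G K"
      using boundaries_close_mono[OF toast(1) _ GE] * by blast
    then show ?thesis
      unfolding ok_def nested_or_disjoint_def using * GE by blast
  qed
  \<comment> \<open>For distinct \<open>E\<close> and \<open>E'\<close> the crossing argument is
    used twice: first to pass from \<open>E'\<close> to \<open>G'\<close>, then from
    \<open>E\<close> to \<open>G\<close>.\<close>
  have inner: "ok G G'" if E: "E \<in> \<C>" "G \<in> H E" and E': "E' \<in> \<C>" "G' \<in> H E'" for E G E' G'
  proof (cases "E = E'")
    case True
    then show ?thesis
      using H E E' unfolding ok_def partial_toast_def by blast
  next
    case False
    then have disj: "E \<inter> E' = {}"
      using \<C> E E' unfolding pairwise_def disjnt_def by blast
    have sub: "G \<subseteq> E" "G' \<subseteq> E'" "E \<noteq> {}"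
      using H[OF E(1)] H[OF E'(1)] E E' partial_toastD(4) by blast+
    have "\<not> boundaries_close q E' E"
      using ok_\<D>[of E' E] False E E' \<C> unfolding ok_def by blast
    then have "\<not> boundaries_close q G' E"
      using boundaries_close_mono[OF toast(1) _ sub(2)] disj by (auto simp: grid_boundary_def)
    moreover have "grid_boundary G' \<inter> E = {}"
      using disj sub by (auto simp: grid_boundary_def)
    ultimately have "\<not> boundaries_close q G G'"
      using boundaries_close_mono[OF toast(1) _ sub(1)] boundaries_close_sym[of q E G'] by blast
    then show ?thesis
      unfolding ok_def nested_or_disjoint_def using disj sub by blast
  qed
  have glueE: "(\<exists>E\<in>\<C>. G \<in> H E) \<or> (G \<in> \<D> \<and> (\<forall>E\<in>\<C>. \<not> G \<subseteq> E))"
    if "G \<in> glue \<D> \<C> H" for G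
    using that by (auto simp: glue_def)
  have "ok D E" if DE: "D \<in> glue \<D> \<C> H" "E \<in> glue \<D> \<C> H" for D E
    using glueE[OF DE(1)]
  proof
    assume "\<exists>E\<in>\<C>. D \<in> H E"
    then obtain D' where D': "D' \<in> \<C>" "D \<in> H D'"
      by blast
    from glueE[OF DE(2)] show ?thesis
      using inner[OF D'] mixed[OF D'] D'(1) by blast
  next
    assume D: "D \<in> \<D> \<and> (\<forall>E\<in>\<C>. \<not> D \<subseteq> E)"
    from glueE[OF DE(2)] show ?thesis
    proof
      assume "\<exists>E'\<in>\<C>. E \<in> H E'"
      then show ?thesis
        using mixed D ok_sym[of D E] by blast
    next
      assume "E \<in> \<D> \<and> (\<forall>E'\<in>\<C>. \<not> E \<subseteq> E')"
      then show ?thesis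
        using D ok_\<D> by blast
    qed
  qed
  moreover have "finite D \<and> grid_connected D" if "D \<in> glue \<D> \<C> H" for D
    using glueE[OF that]
  proof
    assume "\<exists>E\<in>\<C>. D \<in> H E"
    then obtain E where "D \<in> H E" "partial_toast q (H E)"
      using H by blast
    then show ?thesis
      using partial_toastD(2,3) by blast
  next
    assume "D \<in> \<D> \<and> (\<forall>E\<in>\<C>. \<not> D \<subseteq> E)"
    then show ?thesis
      using partial_toastD(2,3)[OF \<D>(1)] by blast
  qed
  ultimately have part: "partial_toast q (glue \<D> \<C> H)"
    unfolding partial_toast_def ok_def by blast
  have "\<exists>D\<in>glue \<D> \<C> H. g \<in> D \<and> h \<in> D" for g h
  proof -
    obtain D where D: "D \<in> \<D>" "g \<in> D" "h \<in> D"
      using \<D>(2) by blast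
    show ?thesis
    proof (cases "\<exists>E\<in>\<C>. D \<subseteq> E")
      case True
      then obtain E where "E \<in> \<C>" "D \<subseteq> E"
        by blast
      then have "E \<in> glue \<D> \<C> H" "g \<in> E" "h \<in> E"
        using H[of E] D by (auto simp: glue_def)
      then show ?thesis by blast
    next
      case False
      then have "D \<in> glue \<D> \<C> H"
        using D by (simp add: glue_def)
      then show ?thesis using D by blast
    qed
  qed
  with part show "toast q (glue \<D> \<C> H)" "noncrossing (glue \<D> \<C> H)"
    using toast_noncrossing_iff by blast+
  fix E assume E: "E \<in> \<C>"
  \<comment> \<open>Pieces are nonempty, so a piece cannot lie in two different members of the
    disjoint family \<open>\<C>\<close>.\<close>
  have "G \<in> H E" if G: "E' \<in> \<C>" "G \<in> H E'" "G \<subseteq> E" for G E'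
  proof -
    have "G \<noteq> {}" "G \<subseteq> E'"
      using H[OF G(1)] G(2) partial_toastD(4) by blast+
    then have "\<not> disjnt E' E"
      using G(3) by (auto simp: disjnt_def)
    then have "E' = E"
      using pairwiseD[OF \<C>(2) G(1) E] by blast
    then show ?thesis
      using G by simp
  qed
  then show "{G \<in> glue \<D> \<C> H. G \<subseteq> E} = H E"
    using E H[OF E] by (auto simp: glue_def)
qed

section \<open>Finite sets and balls\<close>

text \<open>A base vertex \<open>v\<close> is carried through the induction: the two pieces to be
  merged both contain it, hence they are nested and the larger one serves.\<close>

lemma toast_contains_finite:
  fixes \<D> :: "(int ^ 'd) set set"
  assumes toast: "toast q \<D>" "noncrossing \<D>" and "finite X"
  shows "\<exists>D\<in>\<D>. X \<subseteq> D"
proof -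
  have cover: "\<exists>D\<in>\<D>. g \<in> D \<and> h \<in> D" for g h
    using toast(1) by (simp add: toast_def)
  fix v :: "int ^ 'd"
  have "\<exists>D\<in>\<D>. insert v X \<subseteq> D"
    using \<open>finite X\<close>
  proof induction
    case empty
    then show ?case
      using cover[of v v] by blast
  next
    case (insert x X)
    then obtain D where D: "D \<in> \<D>" "insert v X \<subseteq> D"
      by blast
    obtain E where E: "E \<in> \<D>" "v \<in> E" "x \<in> E"
      using cover by blast
    have "D \<subseteq> E \<or> E \<subseteq> D"
      using toast(2) D E unfolding noncrossing_def by blast
    then show ?case
      using D E by blast
  qed
  then show ?thesis by blast
qed

lemma finite_grid_sphere: "finite {y :: int ^ 'd::finite. (x, y) \<in> grid_adj ^^ n}"
proof (induction n)
  case (Suc n)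
  let ?N = "\<lambda>z. range (\<lambda>i. z + axis i 1) \<union> range (\<lambda>i. z - axis i 1)"
  have N: "y \<in> ?N z" if adj: "(z, y) \<in> grid_adj" for y z :: "int ^ 'd"
  proof -
    obtain i where "y = z + axis i 1 \<or> z = y + axis i 1"
      using adj by (auto simp: grid_adj_def)
    then have "y = z + axis i 1 \<or> y = z - axis i 1"
      by auto
    then show ?thesis
      by blast
  qed
  have "{y. (x, y) \<in> grid_adj ^^ Suc n} \<subseteq> (\<Union>z\<in>{z. (x, z) \<in> grid_adj ^^ n}. ?N z)"
  proof (intro subsetI)
    fix y assume "y \<in> {y. (x, y) \<in> grid_adj ^^ Suc n}"
    then obtain z where "(x, z) \<in> grid_adj ^^ n" "(z, y) \<in> grid_adj"
      by auto
    then show "y \<in> (\<Union>z\<in>{z. (x, z) \<in> grid_adj ^^ n}. ?N z)"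
      using N[of z y] by blast
  qed
  moreover have "finite (\<Union>z\<in>{z. (x, z) \<in> grid_adj ^^ n}. ?N z)"
    using Suc.IH by simp
  ultimately show ?case
    by (rule finite_subset)
qed simp

lemma finite_grid_ball:
  fixes \<D> :: "(int ^ 'd::finite) set set"
  assumes "toast q \<D>"
  shows "finite (grid_ball v t :: (int ^ 'd) set)"
proof -
  have "grid_ball v t \<subseteq> (\<Union>n\<in>{..t}. {y. (v, y) \<in> grid_adj ^^ n})"
    using toast_path[OF assms, of v] by (auto simp: grid_ball_def)
  then show ?thesis
    by (rule finite_subset) (simp add: finite_grid_sphere)
qed


section \<open>Positive events in product spaces\<close>

text \<open>The image of a product measure under an injective choice of coordinates is again a
  product measure. The identity gives restriction to fewer coordinates, a shift gives translation of
  random labels.\<close>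

lemma measure_PiM_reindex:
  assumes "\<And>i. i \<in> K \<Longrightarrow> prob_space (M i)" "inj_on f I" "f \<in> I \<rightarrow> K"
    and S: "S \<in> sets (PiM I (\<lambda>i. M (f i)))"
  shows "{\<omega> \<in> space (PiM K M). (\<lambda>i\<in>I. \<omega> (f i)) \<in> S} \<in> sets (PiM K M)"
    and "measure (PiM K M) {\<omega> \<in> space (PiM K M). (\<lambda>i\<in>I. \<omega> (f i)) \<in> S} =
      measure (PiM I (\<lambda>i. M (f i))) S"
proof -
  have meas: "(\<lambda>\<omega>. \<lambda>i\<in>I. \<omega> (f i)) \<in> measurable (PiM K M) (PiM I (\<lambda>i. M (f i)))"
    using assms(3) by (intro measurable_restrict measurable_component_singleton) auto
  have eq: "(\<lambda>\<omega>. \<lambda>i\<in>I. \<omega> (f i)) -` S \<inter> space (PiM K M) =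
      {\<omega> \<in> space (PiM K M). (\<lambda>i\<in>I. \<omega> (f i)) \<in> S}"
    by auto
  show "{\<omega> \<in> space (PiM K M). (\<lambda>i\<in>I. \<omega> (f i)) \<in> S} \<in> sets (PiM K M)"
    using measurable_sets[OF meas S] unfolding eq .
  have "distr (PiM K M) (PiM I (\<lambda>i. M (f i))) (\<lambda>\<omega>. \<lambda>i\<in>I. \<omega> (f i)) = PiM I (\<lambda>i. M (f i))"
    using assms(1-3) by (rule distr_PiM_reindex)
  then show "measure (PiM K M) {\<omega> \<in> space (PiM K M). (\<lambda>i\<in>I. \<omega> (f i)) \<in> S} =
      measure (PiM I (\<lambda>i. M (f i))) S"
    using measure_distr[OF meas S] unfolding eq by simp
qed

text \<open>Restrictions to disjoint sets of coordinates are independent, so the probability is a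
  finite product of positive numbers.\<close>

lemma measure_PiM_disjoint_pos:
  assumes M: "\<And>i. i \<in> I \<Longrightarrow> prob_space (M i)" and I: "I \<noteq> {}"
    and \<C>: "finite \<C>" "pairwise disjnt \<C>" "\<And>E. E \<in> \<C> \<Longrightarrow> E \<subseteq> I"
    and S: "\<And>E. E \<in> \<C> \<Longrightarrow> S E \<in> sets (PiM E M)" "\<And>E. E \<in> \<C> \<Longrightarrow> measure (PiM E M) (S E) > 0"
  shows "{\<omega> \<in> space (PiM I M). \<forall>E\<in>\<C>. restrict \<omega> E \<in> S E} \<in> sets (PiM I M)" (is "?T \<in> _")
    and "measure (PiM I M) {\<omega> \<in> space (PiM I M). \<forall>E\<in>\<C>. restrict \<omega> E \<in> S E} > 0"
proof -
  interpret P: prob_space "PiM I M"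
    using M by (rule prob_space_PiM)
  let ?A = "\<lambda>E. {\<omega> \<in> space (PiM I M). restrict \<omega> E \<in> S E}"
  have A: "?A E \<in> sets (PiM I M)" "measure (PiM I M) (?A E) = measure (PiM E M) (S E)"
    if "E \<in> \<C>" for E
    using measure_PiM_reindex[where f = "\<lambda>i. i" and K = I and I = E and M = M and S = "S E"]
      M S(1)[OF that] \<C>(3)[OF that] by auto
  \<comment> \<open>The empty intersection would be the whole type instead of the space, hence the
    case distinction.\<close>
  have T: "?T = (if \<C> = {} then space (PiM I M) else (\<Inter>E\<in>\<C>. ?A E))"
    by auto
  show "?T \<in> sets (PiM I M)"
    unfolding T using \<C>(1) A(1) by (auto intro!: sets.finite_INT)
  show "measure (PiM I M) ?T > 0"
  proof (cases "\<C> = {}")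
    case True
    then show ?thesis
      by (simp add: P.prob_space)
  next
    case False
    \<comment> \<open>Independence of the coordinates is read off from their joint law, which is the
      product of their individual laws.\<close>
    have "(\<lambda>\<omega>. \<lambda>i\<in>I. \<omega> i) \<in> measurable (PiM I M) (PiM I M)"
      by (intro measurable_restrict measurable_component_singleton)
    moreover have "distr (PiM I M) (PiM I M) (\<lambda>\<omega>. \<lambda>i\<in>I. \<omega> i) =
        PiM I (\<lambda>i. distr (PiM I M) (M i) (\<lambda>\<omega>. \<omega> i))"
      using distr_PiM_reindex[where f = "\<lambda>i. i" and K = I and I = I and M = M] M
      by (simp add: distr_PiM_component cong: PiM_cong)
    ultimately have "P.indep_vars M (\<lambda>i \<omega>. \<omega> i) I"
      using I by (subst P.indep_vars_iff_distr_eq_PiM') (auto intro: measurable_component_singleton)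
    moreover have "disjoint_family_on (\<lambda>E. E) \<C>"
      using \<C>(2) by (auto simp: disjoint_family_on_def pairwise_def disjnt_def)
    ultimately have "P.indep_vars (\<lambda>E. PiM E M) (\<lambda>E \<omega>. restrict \<omega> E) \<C>"
      using P.indep_vars_restrict[of M "\<lambda>i \<omega>. \<omega> i" I \<C> "\<lambda>E. E"] \<C>(3) by simp
    from P.indep_varsD[OF this False \<C>(1) subset_refl S(1)]
    have "measure (PiM I M) (\<Inter>E\<in>\<C>. (\<lambda>\<omega>. restrict \<omega> E) -` S E \<inter> space (PiM I M)) =
        (\<Prod>E\<in>\<C>. measure (PiM I M) ((\<lambda>\<omega>. restrict \<omega> E) -` S E \<inter> space (PiM I M)))"
      by simp
    moreover have "(\<lambda>\<omega>. restrict \<omega> E) -` S E \<inter> space (PiM I M) = ?A E" for E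
      by auto
    ultimately have "measure (PiM I M) (\<Inter>E\<in>\<C>. ?A E) = (\<Prod>E\<in>\<C>. measure (PiM E M) (S E))"
      using A(2) by simp
    then show ?thesis
      unfolding T using False S(2) by (simp add: prod_pos)
  qed
qed

text \<open>Finitely many fibres cover \<open>T\<close>, so by subadditivity they cannot all be null
  sets.\<close>

lemma (in finite_measure) positive_fibre:
  assumes T: "T \<in> sets M" "measure M T > 0" and f: "f \<in> measurable M (count_space UNIV)"
    and Y: "finite Y" "\<And>\<omega>. \<omega> \<in> T \<Longrightarrow> f \<omega> \<in> Y"
  obtains y where "y \<in> Y" "{\<omega> \<in> T. f \<omega> = y} \<in> sets M" "measure M {\<omega> \<in> T. f \<omega> = y} > 0"
proof -
  have eq: "{\<omega> \<in> T. f \<omega> = y} = T \<inter> (f -` {y} \<inter> space M)" for y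
    using sets.sets_into_space[OF T(1)] by auto
  have sets: "{\<omega> \<in> T. f \<omega> = y} \<in> sets M" for y
    unfolding eq using T(1) measurable_sets[OF f, of "{y}"] by auto
  have "T = (\<Union>y\<in>Y. {\<omega> \<in> T. f \<omega> = y})"
    using Y(2) by auto
  then have "measure M T \<le> (\<Sum>y\<in>Y. measure M {\<omega> \<in> T. f \<omega> = y})"
    using finite_measure_subadditive_finite[OF Y(1), of "\<lambda>y. {\<omega> \<in> T. f \<omega> = y}"] sets by auto
  then have "\<not> (\<forall>y\<in>Y. measure M {\<omega> \<in> T. f \<omega> = y} \<le> 0)"
    using T(2) sum_nonpos[of Y "\<lambda>y. measure M {\<omega> \<in> T. f \<omega> = y}"] by auto
  then show ?thesis
    using that sets by (auto simp: not_le)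
qed

lemma prob_space_unit_uniform: "prob_space unit_uniform"
  unfolding unit_uniform_def by (intro prob_space_restrict_space) auto

lemma space_unit_uniform: "space unit_uniform = {0..1}"
  by (simp add: unit_uniform_def)


section \<open>Outputs of positive probability\<close>

lemma toast_input_shift:
  assumes "toast_input L A \<sigma> c" "\<And>x. x \<in> A \<Longrightarrow> \<sigma>' (v + x) = \<sigma> x"
  shows "toast_input L ((+) v ` A) \<sigma>' (\<lambda>x. c (x - v))"
proof -
  have "dom (\<lambda>x. c (x - v)) \<subseteq> (+) v ` A"
  proof
    fix x assume "x \<in> dom (\<lambda>x. c (x - v))"
    then have "x - v \<in> A"
      using assms(1) by (auto simp: toast_input_def)
    then show "x \<in> (+) v ` A"
      by (intro image_eqI[of _ _ "x - v"]) simp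
  qed
  moreover have "ran (\<lambda>x. c (x - v)) \<subseteq> sigma_out L"
    using assms(1) by (auto simp: toast_input_def ran_def)
  ultimately show ?thesis
    using assms grid_connected_shift by (auto simp: toast_input_def)
qed

lemma toast_extension_shift:
  assumes "toast_extension L A c e"
  shows "toast_extension L ((+) v ` A) (\<lambda>x. c (x - v)) (\<lambda>x. e (x - v))"
proof -
  have "dom (\<lambda>x. e (x - v)) = (+) v ` A"
  proof -
    have "x \<in> dom (\<lambda>x. e (x - v)) \<longleftrightarrow> x - v \<in> A" for x
      using assms by (auto simp: toast_extension_def)
    moreover have "x - v \<in> A \<longleftrightarrow> x \<in> (+) v ` A" for x
      by (auto simp: image_iff algebra_simps intro: bexI[of _ "x - v"])
    ultimately show ?thesis by blast
  qed
  moreover have "ran (\<lambda>x. e (x - v)) \<subseteq> sigma_out L"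
    using assms by (auto simp: toast_extension_def ran_def)
  ultimately show ?thesis
    using assms by (auto simp: toast_extension_def map_le_def)
qed

lemma grid_iso_shift: "grid_iso A ((+) v ` A) ((+) v)"
  by (auto simp: grid_iso_def bij_betw_def inj_on_def add.assoc)

locale randomized_algorithm =
  fixes L :: "('i, 'o, 'd::finite) lcl"
    and R :: "(int ^ 'd \<Rightarrow> 'i) \<Rightarrow> (int ^ 'd \<Rightarrow> real) \<Rightarrow> (int ^ 'd) set \<Rightarrow> (int ^ 'd \<rightharpoonup> 'o) \<Rightarrow>
      (int ^ 'd \<rightharpoonup> 'o)"
    and q :: nat
  assumes lcl: "is_lcl L"
    and alg: "randomized_toast_algorithm L R"
begin

abbreviation random_labels :: "(int ^ 'd) set \<Rightarrow> (int ^ 'd \<Rightarrow> real) measure" where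
  "random_labels A \<equiv> PiM A (\<lambda>_. unit_uniform)"

lemma space_random_labels: "\<omega> \<in> space (random_labels A) \<Longrightarrow> \<omega> ` A \<subseteq> {0..1}"
  by (auto simp: space_PiM space_unit_uniform)

sublocale labels: prob_space "random_labels A" for A
  by (intro prob_space_PiM prob_space_unit_uniform)

lemma R_extension:
  "toast_input L A \<sigma> c \<Longrightarrow> \<omega> ` A \<subseteq> {0..1} \<Longrightarrow> toast_extension L A c (R \<sigma> \<omega> A c)"
  using alg by (simp add: randomized_toast_algorithm_def)

lemma R_measurable:
  "toast_input L A \<sigma> c \<Longrightarrow> (\<lambda>\<omega>. R \<sigma> \<omega> A c) \<in> measurable (random_labels A) (count_space UNIV)"
  using alg by (simp add: randomized_toast_algorithm_def)

lemma R_invariant: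
  assumes "toast_input L A \<sigma> c" "\<omega> ` A \<subseteq> {0..1}" "toast_input L B \<sigma>' c'" "\<omega>' ` B \<subseteq> {0..1}"
    and "grid_iso A B \<phi>" "\<And>x. x \<in> A \<Longrightarrow> \<sigma>' (\<phi> x) = \<sigma> x \<and> \<omega>' (\<phi> x) = \<omega> x \<and> c' (\<phi> x) = c x"
    and "x \<in> A"
  shows "R \<sigma>' \<omega>' B c' (\<phi> x) = R \<sigma> \<omega> A c x"
  by (rule alg[unfolded randomized_toast_algorithm_def, THEN conjunct2, THEN conjunct1,
        rule_format, where \<phi> = \<phi> and x = x])
    (simp_all add: assms)

text \<open>Invariance compares values only on \<open>A\<close>. Outside, both sides are undefined
  because outputs have the piece as their domain, which gives an equality of functions.\<close>

lemma R_shift: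
  assumes inp: "toast_input L A \<sigma> c" and \<omega>: "\<omega> ` A \<subseteq> {0..1}"
    and shift: "\<And>x. x \<in> A \<Longrightarrow> \<sigma>' (v + x) = \<sigma> x" "\<And>x. x \<in> A \<Longrightarrow> \<omega>' (v + x) = \<omega> x"
  shows "R \<sigma>' \<omega>' ((+) v ` A) (\<lambda>x. c (x - v)) = (\<lambda>x. R \<sigma> \<omega> A c (x - v))"
proof
  fix y
  let ?B = "(+) v ` A" and ?c = "\<lambda>x. c (x - v)"
  have inp': "toast_input L ?B \<sigma>' ?c"
    using inp shift(1) by (rule toast_input_shift)
  have \<omega>': "\<omega>' ` ?B \<subseteq> {0..1}"
    using \<omega> shift(2) by auto
  show "R \<sigma>' \<omega>' ?B ?c y = R \<sigma> \<omega> A c (y - v)"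
  proof (cases "y \<in> ?B")
    case True
    then obtain x where x: "x \<in> A" "y = v + x"
      by blast
    have "R \<sigma>' \<omega>' ?B ?c (v + x) = R \<sigma> \<omega> A c x"
      using shift x(1) by (intro R_invariant[OF inp \<omega> inp' \<omega>' grid_iso_shift]) simp_all
    then show ?thesis
      using x by simp
  next
    case False
    then have "y - v \<notin> A"
      using image_eqI[of y "(+) v" "y - v"] by auto
    then have "y - v \<notin> dom (R \<sigma> \<omega> A c)" "y \<notin> dom (R \<sigma>' \<omega>' ?B ?c)"
      using False R_extension[OF inp' \<omega>'] R_extension[OF inp \<omega>]
      by (simp_all add: toast_extension_def)
    then show ?thesis
      by (simp add: domIff)
  qed
qed

lemma R_extending:
  assumes "partial_toast q H" "\<And>B. B \<in> H \<Longrightarrow> B \<subseteq> A" "\<sigma> ` A \<subseteq> sigma_in L" "\<omega> ` A \<subseteq> {0..1}"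
  shows "extending (sigma_out L) (R \<sigma> \<omega>) H"
  unfolding extending_def
proof (intro ballI allI impI)
  fix B c assume B: "B \<in> H" and c: "dom c \<subseteq> B \<and> ran c \<subseteq> sigma_out L"
  have "toast_input L B \<sigma> c"
    using partial_toastD(2,3)[OF assms(1) B] c assms(2)[OF B] assms(3) by (auto simp: toast_input_def)
  then have "toast_extension L B c (R \<sigma> \<omega> B c)"
    by (rule R_extension) (use assms(2)[OF B] assms(4) in auto)
  then show "dom (R \<sigma> \<omega> B c) = B \<and> ran (R \<sigma> \<omega> B c) \<subseteq> sigma_out L \<and> c \<subseteq>\<^sub>m R \<sigma> \<omega> B c"
    by (simp add: toast_extension_def)
qed

text \<open>What a noncrossing toast that contains \<open>A\<close> may look like inside
  \<open>A\<close>: a possible past of the computation at \<open>A\<close>.\<close>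

definition history :: "(int ^ 'd) set \<Rightarrow> (int ^ 'd) set set \<Rightarrow> bool" where
  "history A H \<longleftrightarrow> partial_toast q H \<and> A \<in> H \<and> (\<forall>G\<in>H. G \<subseteq> A)"

lemma eval_shift:
  assumes H: "history A H" and \<sigma>: "\<sigma> ` A \<subseteq> sigma_in L" and \<omega>: "\<omega> ` A \<subseteq> {0..1}"
    and shift: "\<And>x. x \<in> A \<Longrightarrow> \<sigma>' (v + x) = \<sigma> x" "\<And>x. x \<in> A \<Longrightarrow> \<omega>' (v + x) = \<omega> x"
    and H': "{G \<in> H'. G \<subseteq> (+) v ` A} = (`) ((+) v) ` H"
  shows "toast_eval (R \<sigma>' \<omega>') H' ((+) v ` A) = (\<lambda>x. toast_eval (R \<sigma> \<omega>) H A (x - v))"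
proof (rule toast_eval_transport[where S = "sigma_out L" and A = A])
  have part: "partial_toast q H" and sub: "\<And>B. B \<in> H \<Longrightarrow> B \<subseteq> A" and A: "A \<in> H"
    using H by (auto simp: history_def)
  show "noncrossing H" "\<forall>B\<in>H. finite B"
    using partial_toastD(1,5)[OF part] .
  show "extending (sigma_out L) (R \<sigma> \<omega>) H"
    using part sub \<sigma> \<omega> by (rule R_extending)
  show "{G \<in> H'. G \<subseteq> (+) v ` A} = (`) ((+) v) ` {G \<in> H. G \<subseteq> A}"
    unfolding H' using sub by (intro arg_cong[where f = "image _"]) blast
  show "A \<in> H" "A \<subseteq> A"
    using A by simp_all
  fix B c assume B: "B \<in> H" "B \<subseteq> A" "dom c \<subseteq> B" "ran c \<subseteq> sigma_out L"
  have "\<sigma> ` B \<subseteq> sigma_in L"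
    using B(2) \<sigma> by blast
  then have "toast_input L B \<sigma> c"
    using partial_toastD(2,3)[OF part B(1)] B by (simp add: toast_input_def)
  then show "R \<sigma>' \<omega>' ((+) v ` B) (\<lambda>x. c (x - v)) = (\<lambda>x. R \<sigma> \<omega> B c (x - v))"
    by (rule R_shift) (use \<omega> B shift in auto)
qed

text \<open>The trivial translation in \<open>eval_shift\<close>: in a larger toast, the output on
  \<open>A\<close> is determined by the pieces and random labels inside \<open>A\<close>.\<close>

lemma eval_restrict:
  assumes "history A H" "\<sigma> ` A \<subseteq> sigma_in L" "\<omega> ` A \<subseteq> {0..1}" "{G \<in> H'. G \<subseteq> A} = H"
  shows "toast_eval (R \<sigma> \<omega>) H' A = toast_eval (R \<sigma> (restrict \<omega> A)) H A"
  using eval_shift[OF assms(1,2), of "restrict \<omega> A" \<sigma> 0 \<omega> H'] assms(3,4)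
  by (simp add: image_def)

text \<open>
  The history witnessing that an output is nice need not be the one along which it was computed;
  this is what allows a deterministic algorithm, which does not know the history, to maintain
  niceness.
\<close>

definition nice :: "(int ^ 'd \<Rightarrow> 'i) \<Rightarrow> (int ^ 'd) set \<Rightarrow> (int ^ 'd \<rightharpoonup> 'o) \<Rightarrow> bool" where
  "nice \<sigma> A e \<longleftrightarrow> (\<exists>H S. history A H \<and> S \<in> sets (random_labels A) \<and>
     measure (random_labels A) S > 0 \<and> (\<forall>\<omega>\<in>S. toast_eval (R \<sigma> \<omega>) H A = e))"

text \<open>History and event are translated together. Shifting coordinates preserves the
  probability of the event, and evaluation commutes with the shift.\<close>

lemma nice_shift:
  assumes nice: "nice \<sigma> A e" and \<sigma>: "\<sigma> ` A \<subseteq> sigma_in L"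
    and shift: "\<And>x. x \<in> A \<Longrightarrow> \<sigma>' (v + x) = \<sigma> x"
  shows "nice \<sigma>' ((+) v ` A) (\<lambda>x. e (x - v))"
proof -
  obtain H S where H: "history A H" and S: "S \<in> sets (random_labels A)"
    "measure (random_labels A) S > 0" and e: "\<And>\<omega>. \<omega> \<in> S \<Longrightarrow> toast_eval (R \<sigma> \<omega>) H A = e"
    using nice unfolding nice_def by blast
  let ?B = "(+) v ` A" and ?H = "(`) ((+) v) ` H"
  let ?S = "{\<omega> \<in> space (random_labels ?B). (\<lambda>x\<in>A. \<omega> (v + x)) \<in> S}"
  have "history ?B ?H"
    using H partial_toast_shift[of q H v] by (auto simp: history_def)
  moreover have "?S \<in> sets (random_labels ?B)" "measure (random_labels ?B) ?S > 0"
    using measure_PiM_reindex[where f = "(+) v" and I = A and K = ?B and S = S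
        and M = "\<lambda>_. unit_uniform"] S prob_space_unit_uniform by auto
  moreover have "toast_eval (R \<sigma>' \<omega>) ?H ?B = (\<lambda>x. e (x - v))" if \<omega>: "\<omega> \<in> ?S" for \<omega>
  proof -
    let ?\<eta> = "\<lambda>x\<in>A. \<omega> (v + x)"
    have "?\<eta> \<in> space (random_labels A)"
      using \<omega> S(1) sets.sets_into_space by blast
    then have "?\<eta> ` A \<subseteq> {0..1}"
      by (rule space_random_labels)
    moreover have "{G \<in> ?H. G \<subseteq> ?B} = ?H"
      using H by (auto simp: history_def)
    ultimately have "toast_eval (R \<sigma>' \<omega>) ?H ?B = (\<lambda>x. toast_eval (R \<sigma> ?\<eta>) H A (x - v))"
      using H \<sigma> shift by (intro eval_shift) auto
    then show ?thesis
      using e \<omega> by simp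
  qed
  ultimately show ?thesis
    unfolding nice_def by blast
qed

text \<open>The map \<open>F\<close> is arbitrary here: only the niceness of its outputs below
  \<open>D\<close> matters. Their separate witnesses combine into one witness for
  \<open>D\<close>.\<close>

lemma nice_extension_exists:
  assumes toast: "toast q \<D>" "noncrossing \<D>" and D: "D \<in> \<D>" and \<sigma>: "range \<sigma> \<subseteq> sigma_in L"
    and ext: "extending (sigma_out L) F \<D>"
    and nice: "\<And>E. E \<in> \<D> \<Longrightarrow> E \<subset> D \<Longrightarrow> nice \<sigma> E (toast_eval F \<D> E)"
  shows "\<exists>e. toast_extension L D (sub_eval F \<D> D) e \<and> nice \<sigma> D e"
proof -
  have part: "partial_toast q \<D>"
    using toast toast_noncrossing_iff by blast
  note pieces = partial_toastD[OF part]
  note ev = toast_eval_extends[OF pieces(1,5) ext]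
  \<comment> \<open>Only maximal proper subpieces are used. They are disjoint, so their events
    concern independent labels, and their outputs already contain those of all smaller
    pieces.\<close>
  define \<C> where "\<C> = {E \<in> \<D>. E \<subset> D \<and> (\<forall>G\<in>\<D>. E \<subset> G \<longrightarrow> \<not> G \<subset> D)}"
  have \<C>D: "E \<in> \<D>" "E \<subset> D" "E \<subseteq> D" if "E \<in> \<C>" for E
    using that by (auto simp: \<C>_def)
  have finD: "finite D"
    using pieces(2)[OF D] .
  have "\<C> \<subseteq> Pow D"
    using \<C>D(3) by blast
  then have fin\<C>: "finite \<C>"
    using finD finite_subset by blast
  have disj: "pairwise disjnt \<C>"
  proof (rule pairwiseI)
    fix E E' assume E: "E \<in> \<C>" "E' \<in> \<C>" "E \<noteq> E'"
    then have "E \<subseteq> E' \<or> E' \<subseteq> E \<or> E \<inter> E' = {}"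
      using pieces(1) \<C>D(1) unfolding noncrossing_def by blast
    then show "disjnt E E'"
      using E unfolding \<C>_def disjnt_def by blast
  qed
  have maximal: "\<exists>E\<in>\<C>. G \<subseteq> E" if G: "G \<in> \<D>" "G \<subset> D" for G
  proof -
    have "{E \<in> \<D>. E \<subset> D} \<subseteq> Pow D"
      by blast
    then have "finite {E \<in> \<D>. E \<subset> D}"
      using finD finite_subset by blast
    moreover have "G \<in> {E \<in> \<D>. E \<subset> D}"
      using G by simp
    ultimately obtain E where E: "E \<in> {E \<in> \<D>. E \<subset> D}" "G \<subseteq> E"
      "\<forall>B\<in>{E \<in> \<D>. E \<subset> D}. E \<subseteq> B \<longrightarrow> E = B"
      by (rule finite_has_maximal2[THEN bexE]) blast
    then have "E \<in> \<C>"
      unfolding \<C>_def by blast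
    then show ?thesis
      using E(2) by blast
  qed
  have "\<forall>E\<in>\<C>. \<exists>H S. history E H \<and> S \<in> sets (random_labels E) \<and>
      measure (random_labels E) S > 0 \<and> (\<forall>\<omega>\<in>S. toast_eval (R \<sigma> \<omega>) H E = toast_eval F \<D> E)"
    using nice[unfolded nice_def] \<C>D(1,2) by blast
  then obtain H S where HS: "\<forall>E\<in>\<C>. history E (H E) \<and> S E \<in> sets (random_labels E) \<and>
      measure (random_labels E) (S E) > 0 \<and>
      (\<forall>\<omega>\<in>S E. toast_eval (R \<sigma> \<omega>) (H E) E = toast_eval F \<D> E)"
    unfolding bchoice_iff by blast
  \<comment> \<open>The history for \<open>D\<close>: below each maximal subpiece the given toast is
    replaced by the history that witnesses niceness there.\<close>
  define K where "K = {G \<in> glue \<D> \<C> H. G \<subseteq> D}"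
  have \<C>sub: "\<C> \<subseteq> \<D>"
    using \<C>D(1) by blast
  have Hpart: "partial_toast q (H E) \<and> E \<in> H E \<and> (\<forall>G\<in>H E. G \<subseteq> E)" if "E \<in> \<C>" for E
    using HS that by (simp add: history_def)
  have glue: "toast q (glue \<D> \<C> H)" "noncrossing (glue \<D> \<C> H)"
    "\<And>E. E \<in> \<C> \<Longrightarrow> {G \<in> glue \<D> \<C> H. G \<subseteq> E} = H E"
    using glue_toast[OF toast \<C>sub disj, of H] Hpart by simp_all
  have "partial_toast q (glue \<D> \<C> H)"
    using toast_noncrossing_iff[THEN iffD1, OF conjI, OF glue(1,2)] by blast
  then have Kpart: "partial_toast q K"
    by (rule partial_toast_subset) (simp add: K_def)
  note Kpieces = partial_toastD[OF Kpart]
  have DK: "D \<in> K"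
    using D \<C>D(2) by (auto simp: K_def glue_def)
  have histD: "history D K"
    using Kpart DK by (simp add: history_def K_def)
  have H_eq: "{G \<in> K. G \<subseteq> E} = H E" if "E \<in> \<C>" for E
    using glue(3)[OF that] \<C>D(3)[OF that] by (auto simp: K_def)
  have \<C>K: "E \<in> K" if "E \<in> \<C>" for E
    using H_eq[OF that] Hpart[OF that] by blast
  have Ksub: "\<exists>E\<in>\<C>. G \<subseteq> E" if "G \<in> K" "G \<subset> D" for G
  proof -
    from that(1) consider E where "E \<in> \<C>" "G \<in> H E" | "G \<in> \<D>"
      by (auto simp: K_def glue_def)
    then show ?thesis
      using Hpart maximal that(2) by cases blast+
  qed
  let ?c = "sub_eval F \<D> D"
  have inp: "toast_input L D \<sigma> ?c"
    using pieces(2,3)[OF D] ev(3,4)[OF D] \<sigma> by (auto simp: toast_input_def)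
  let ?T = "{\<omega> \<in> space (random_labels D). \<forall>E\<in>\<C>. restrict \<omega> E \<in> S E}"
  have T: "?T \<in> sets (random_labels D)" "measure (random_labels D) ?T > 0"
    using measure_PiM_disjoint_pos[where M = "\<lambda>_. unit_uniform" and I = D and \<C> = \<C> and S = S]
      prob_space_unit_uniform pieces(4)[OF D] fin\<C> disj \<C>D(3) HS by auto
  have unit: "\<omega> ` D \<subseteq> {0..1}" if "\<omega> \<in> ?T" for \<omega>
    using that by (intro space_random_labels) blast
  \<comment> \<open>On the event \<open>?T\<close>, the randomized algorithm along \<open>K\<close>
    arrives at \<open>D\<close> with the same partial map as \<open>F\<close> along
    \<open>\<D>\<close>: both agree on the maximal subpieces and are undefined elsewhere.\<close>
  have sub: "sub_eval (R \<sigma> \<omega>) K D = ?c" if \<omega>: "\<omega> \<in> ?T" for \<omega>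
  proof
    fix x
    have Kext: "extending (sigma_out L) (R \<sigma> \<omega>) K"
      using Kpart _ _ unit[OF \<omega>] by (rule R_extending) (use \<sigma> K_def in auto)
    note Kev = toast_eval_extends[OF Kpieces(1,5) Kext]
    show "sub_eval (R \<sigma> \<omega>) K D x = ?c x"
    proof (cases "\<exists>E\<in>\<C>. x \<in> E")
      case True
      then obtain E where E: "E \<in> \<C>" "x \<in> E"
        by blast
      have unitE: "\<omega> ` E \<subseteq> {0..1}"
        using image_mono[OF \<C>D(3)[OF E(1)]] unit[OF \<omega>] by (rule subset_trans)
      have "sub_eval (R \<sigma> \<omega>) K D x = toast_eval (R \<sigma> \<omega>) K E x"
        using Kev(5)[OF DK \<C>K[OF E(1)] \<C>D(2)[OF E(1)]] Kev(1)[OF \<C>K[OF E(1)]] E(2)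
        by (simp add: map_le_def)
      also have "toast_eval (R \<sigma> \<omega>) K E = toast_eval (R \<sigma> (restrict \<omega> E)) (H E) E"
        by (rule eval_restrict) (use HS E(1) \<sigma> unitE H_eq[OF E(1)] in auto)
      also have "\<dots> = toast_eval F \<D> E"
        using HS \<omega> E(1) by blast
      also have "toast_eval F \<D> E x = ?c x"
        using ev(5)[OF D \<C>D(1,2)[OF E(1)]] ev(1)[OF \<C>D(1)[OF E(1)]] E(2)
        by (simp add: map_le_def)
      finally show ?thesis .
    next
      case False
      then have "x \<notin> dom (sub_eval (R \<sigma> \<omega>) K D)"
        using dom_sub_eval[OF Kpieces(1,5) Kext] Ksub by blast
      moreover have "x \<notin> dom ?c"
        using dom_sub_eval[OF pieces(1,5) ext] maximal False by blast
      ultimately show ?thesis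
        by (simp add: domIff)
    qed
  qed
  have eval: "toast_eval (R \<sigma> \<omega>) K D = R \<sigma> \<omega> D ?c" if "\<omega> \<in> ?T" for \<omega>
    using sub[OF that] finD by (simp add: toast_eval_finite)
  \<comment> \<open>Since \<open>D\<close> and the output alphabet are finite, the next step of the
    algorithm has finitely many possible results, and one of them has positive probability.\<close>
  let ?Y = "{e. dom e = D \<and> ran e \<subseteq> sigma_out L}"
  have "finite ?Y"
    using finD lcl by (intro finite_set_of_finite_maps) (auto simp: is_lcl_def)
  moreover have RY: "toast_extension L D ?c (R \<sigma> \<omega> D ?c)" if "\<omega> \<in> ?T" for \<omega>
    using inp unit[OF that] by (rule R_extension)
  then have "R \<sigma> \<omega> D ?c \<in> ?Y" if "\<omega> \<in> ?T" for \<omega>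
    using that by (auto simp: toast_extension_def)
  ultimately obtain e where e: "{\<omega> \<in> ?T. R \<sigma> \<omega> D ?c = e} \<in> sets (random_labels D)"
    "measure (random_labels D) {\<omega> \<in> ?T. R \<sigma> \<omega> D ?c = e} > 0"
    using labels.positive_fibre[OF T R_measurable[OF inp], of ?Y] by blast
  have "nice \<sigma> D e"
    unfolding nice_def using histD e eval by (intro exI conjI) auto
  \<comment> \<open>An event of positive probability contains a point, and at that point
    \<open>e\<close> is a genuine output of the algorithm.\<close>
  moreover have "{\<omega> \<in> ?T. R \<sigma> \<omega> D ?c = e} \<noteq> {}"
    using e(2) by (metis less_irrefl measure_empty)
  then have "toast_extension L D ?c e"
    using RY by blast
  ultimately show ?thesis by blast
qed


section \<open>The deterministic algorithm\<close>

text \<open>The componentwise minimum serves to choose a representative of each translation class.\<close>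

definition corner :: "(int ^ 'd) set \<Rightarrow> int ^ 'd" where
  "corner A = (\<chi> i. Min ((\<lambda>x. x $ i) ` A))"

lemma corner_shift:
  assumes "finite A" "A \<noteq> {}"
  shows "corner ((+) v ` A) = v + corner A"
proof -
  have "Min ((\<lambda>x. x $ i + v $ i) ` A) = Min ((\<lambda>x. x $ i) ` A) + v $ i" for i
    using assms by (rule Min_add_commute)
  then show ?thesis
    by (simp add: corner_def vec_eq_iff image_image add.commute)
qed

text \<open>The implication inside the choice keeps it satisfiable on every admissible input, since
  an algorithm must extend inputs that have no nice extension too.\<close>

definition choose_extension ::
  "(int ^ 'd \<Rightarrow> 'i) \<Rightarrow> (int ^ 'd) set \<Rightarrow> (int ^ 'd \<rightharpoonup> 'o) \<Rightarrow> (int ^ 'd \<rightharpoonup> 'o)" where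
  "choose_extension \<sigma> A c = (SOME e. toast_extension L A c e \<and>
     ((\<exists>e'. toast_extension L A c e' \<and> nice \<sigma> A e') \<longrightarrow> nice \<sigma> A e))"

lemma choose_extension:
  assumes "toast_input L A \<sigma> c"
  shows "toast_extension L A c (choose_extension \<sigma> A c)"
    and "toast_extension L A c e \<Longrightarrow> nice \<sigma> A e \<Longrightarrow> nice \<sigma> A (choose_extension \<sigma> A c)"
proof -
  \<comment> \<open>Running the randomized algorithm with all labels 0, a point of the unit
    interval, shows that some extension exists.\<close>
  have "toast_extension L A c (R \<sigma> (\<lambda>_. 0) A c)"
    using assms by (rule R_extension) auto
  then have "\<exists>e. toast_extension L A c e \<and>
      ((\<exists>e'. toast_extension L A c e' \<and> nice \<sigma> A e') \<longrightarrow> nice \<sigma> A e)"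
    by blast
  from someI_ex[OF this]
  show "toast_extension L A c (choose_extension \<sigma> A c)"
    and "toast_extension L A c e \<Longrightarrow> nice \<sigma> A e \<Longrightarrow> nice \<sigma> A (choose_extension \<sigma> A c)"
    unfolding choose_extension_def by blast+
qed

text \<open>Choices made separately at two translates need not correspond. The choice is therefore
  made on the translate whose corner is the origin, with input labels outside it erased, and then
  moved back.\<close>

definition derandomized ::
  "(int ^ 'd \<Rightarrow> 'i) \<Rightarrow> (int ^ 'd) set \<Rightarrow> (int ^ 'd \<rightharpoonup> 'o) \<Rightarrow> (int ^ 'd \<rightharpoonup> 'o)" where
  "derandomized \<sigma> A c = (let a = corner A; B = (+) (- a) ` A in
     (\<lambda>x. choose_extension (\<lambda>x. if x \<in> B then \<sigma> (a + x) else undefined) B (\<lambda>x. c (a + x)) (x - a)))"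

text \<open>Extension and niceness are invariant under translation, so both properties of the choice
  at the origin carry over to \<open>A\<close>.\<close>

lemma derandomized:
  assumes inp: "toast_input L A \<sigma> c"
  shows "toast_extension L A c (derandomized \<sigma> A c)"
    and "toast_extension L A c e \<Longrightarrow> nice \<sigma> A e \<Longrightarrow> nice \<sigma> A (derandomized \<sigma> A c)"
proof -
  define a where "a = corner A"
  define B where "B = (+) (- a) ` A"
  define \<sigma>\<^sub>0 where "\<sigma>\<^sub>0 = (\<lambda>x. if x \<in> B then \<sigma> (a + x) else undefined)"
  define c\<^sub>0 where "c\<^sub>0 = (\<lambda>x. c (a + x))"
  have der: "derandomized \<sigma> A c = (\<lambda>x. choose_extension \<sigma>\<^sub>0 B c\<^sub>0 (x - a))"
    unfolding derandomized_def Let_def \<sigma>\<^sub>0_def c\<^sub>0_def B_def a_def ..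
  have A: "A = (+) a ` B"
    by (simp add: B_def image_image)
  have c: "c = (\<lambda>x. c\<^sub>0 (x - a))"
    by (simp add: c\<^sub>0_def)
  have c\<^sub>0: "c\<^sub>0 = (\<lambda>x. c (x - - a))"
    by (simp add: c\<^sub>0_def add.commute)
  have \<sigma>\<^sub>0: "\<sigma>\<^sub>0 (- a + x) = \<sigma> x" if "x \<in> A" for x
    using that by (simp add: \<sigma>\<^sub>0_def B_def)
  have \<sigma>: "\<sigma> (a + x) = \<sigma>\<^sub>0 x" if "x \<in> B" for x
    using that by (simp add: \<sigma>\<^sub>0_def)
  have \<sigma>in: "\<sigma> ` A \<subseteq> sigma_in L"
    using inp by (simp add: toast_input_def)
  have inp\<^sub>0: "toast_input L B \<sigma>\<^sub>0 c\<^sub>0"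
    unfolding B_def c\<^sub>0 using inp \<sigma>\<^sub>0 by (rule toast_input_shift)
  have \<sigma>\<^sub>0in: "\<sigma>\<^sub>0 ` B \<subseteq> sigma_in L"
    using inp\<^sub>0 by (simp add: toast_input_def)
  show "toast_extension L A c (derandomized \<sigma> A c)"
    unfolding der using toast_extension_shift[OF choose_extension(1)[OF inp\<^sub>0], of a]
    by (simp only: A[symmetric] c[symmetric])
  assume e: "toast_extension L A c e" "nice \<sigma> A e"
  let ?e = "\<lambda>x. e (x - - a)"
  have "toast_extension L B c\<^sub>0 ?e"
    unfolding B_def c\<^sub>0 using e(1) by (rule toast_extension_shift)
  moreover have "nice \<sigma>\<^sub>0 B ?e"
    unfolding B_def using e(2) \<sigma>in \<sigma>\<^sub>0 by (rule nice_shift)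
  ultimately have "nice \<sigma>\<^sub>0 B (choose_extension \<sigma>\<^sub>0 B c\<^sub>0)"
    by (rule choose_extension(2)[OF inp\<^sub>0])
  from nice_shift[OF this \<sigma>\<^sub>0in, of \<sigma> a] \<sigma>
  show "nice \<sigma> A (derandomized \<sigma> A c)"
    unfolding der A[symmetric] by blast
qed

text \<open>After normalization both inputs become literally equal, so the choice operator returns
  the same map.\<close>

lemma derandomized_shift:
  assumes inp: "toast_input L A \<sigma> c" "toast_input L ((+) v ` A) \<sigma>' c'"
    and eq: "\<And>x. x \<in> A \<Longrightarrow> \<sigma>' (v + x) = \<sigma> x" "\<And>x. x \<in> A \<Longrightarrow> c' (v + x) = c x"
  shows "derandomized \<sigma>' ((+) v ` A) c' (v + x) = derandomized \<sigma> A c x"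
proof -
  define a where "a = corner A"
  define B where "B = (+) (- a) ` A"
  have "finite A" "A \<noteq> {}"
    using inp(1) by (auto simp: toast_input_def grid_connected_def)
  then have a': "corner ((+) v ` A) = v + a"
    by (simp add: a_def corner_shift)
  have B': "(+) (- (v + a)) ` (+) v ` A = B"
    by (simp add: B_def image_image algebra_simps)
  have \<sigma>: "(\<lambda>x. if x \<in> B then \<sigma>' (v + a + x) else undefined) =
      (\<lambda>x. if x \<in> B then \<sigma> (a + x) else undefined)"
    using eq(1) by (auto simp: B_def fun_eq_iff add.assoc)
  have "c' (v + y) = c y" for y
  proof (cases "y \<in> A")
    case False
    then have "y \<notin> dom c" "v + y \<notin> dom c'"
      using inp by (auto simp: toast_input_def)
    then show ?thesis
      by (simp add: domIff)
  qed (rule eq(2))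
  then have c: "(\<lambda>x. c' (v + a + x)) = (\<lambda>x. c (a + x))"
    by (simp add: add.assoc)
  have "v + x - (v + a) = x - a"
    by simp
  then show ?thesis
    unfolding derandomized_def Let_def a' B' \<sigma> c a_def[symmetric] B_def[symmetric] by simp
qed

text \<open>Across each edge the point and its image change by the same generator, so their
  difference is constant on a connected set.\<close>

lemma grid_iso_translation:
  fixes \<phi> :: "int ^ 'd \<Rightarrow> int ^ 'd"
  assumes "grid_connected A" "grid_iso A B \<phi>"
  obtains v where "B = (+) v ` A" "\<And>x. x \<in> A \<Longrightarrow> \<phi> x = v + x"
proof -
  obtain a where a: "a \<in> A"
    using assms(1) unfolding grid_connected_def by blast
  have "\<phi> x = (\<phi> a - a) + x" if "(a, x) \<in> (grid_adj \<inter> A \<times> A)\<^sup>*" for x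
    using that
  proof induction
    case (step x y)
    then have xy: "x \<in> A" "y \<in> A" "(x, y) \<in> grid_adj"
      by auto
    from xy(3) obtain i where "y = x + axis i 1 \<or> x = y + axis i 1"
      by (auto simp: grid_adj_def)
    then have "y = x + axis i 1 \<and> \<phi> y = \<phi> x + axis i 1 \<or> x = y + axis i 1 \<and> \<phi> x = \<phi> y + axis i 1"
      using assms(2) xy(1,2) unfolding grid_iso_def by blast
    then show ?case
      using step.IH by (auto simp: algebra_simps)
  qed simp
  then have \<phi>: "\<phi> x = (\<phi> a - a) + x" if "x \<in> A" for x
    using assms(1) a that unfolding grid_connected_def by blast
  moreover have "B = \<phi> ` A"
    using assms(2) by (simp add: grid_iso_def bij_betw_def)
  then have "B = (+) (\<phi> a - a) ` A"
    using \<phi> by (simp cong: image_cong)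
  ultimately show ?thesis
    using that by blast
qed

lemma toast_algorithm_derandomized: "toast_algorithm L derandomized"
  unfolding toast_algorithm_def
proof (intro conjI allI impI ballI)
  fix A \<sigma> c assume "toast_input L A \<sigma> c"
  then show "toast_extension L A c (derandomized \<sigma> A c)"
    by (rule derandomized(1))
next
  fix A \<sigma> c B \<sigma>' c' \<phi> x
  assume *: "toast_input L A \<sigma> c \<and> toast_input L B \<sigma>' c' \<and> grid_iso A B \<phi> \<and>
    (\<forall>x\<in>A. \<sigma>' (\<phi> x) = \<sigma> x \<and> c' (\<phi> x) = c x)" and x: "x \<in> A"
  then have "grid_connected A" "grid_iso A B \<phi>"
    by (simp_all add: toast_input_def)
  then obtain v where "B = (+) v ` A" "\<And>x. x \<in> A \<Longrightarrow> \<phi> x = v + x"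
    by (rule grid_iso_translation) blast
  then show "derandomized \<sigma>' B c' (\<phi> x) = derandomized \<sigma> A c x"
    using * x by (auto intro!: derandomized_shift)
qed

section \<open>Correctness of the derandomized algorithm\<close>

lemma derandomized_extending:
  assumes "partial_toast q H" "range \<sigma> \<subseteq> sigma_in L"
  shows "extending (sigma_out L) (derandomized \<sigma>) H"
  unfolding extending_def
proof (intro ballI allI impI)
  fix B c assume B: "B \<in> H" and c: "dom c \<subseteq> B \<and> ran c \<subseteq> sigma_out L"
  have "toast_input L B \<sigma> c"
    using partial_toastD(2,3)[OF assms(1) B] c assms(2) by (auto simp: toast_input_def)
  from derandomized(1)[OF this]
  show "dom (derandomized \<sigma> B c) = B \<and> ran (derandomized \<sigma> B c) \<subseteq> sigma_out L \<and>
      c \<subseteq>\<^sub>m derandomized \<sigma> B c"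
    by (simp add: toast_extension_def)
qed

text \<open>Niceness propagates up the toast: once all smaller outputs are nice, a nice extension
  exists, and the algorithm then picks one.\<close>

lemma nice_derandomized:
  assumes toast: "toast q \<D>" "noncrossing \<D>" and \<sigma>: "range \<sigma> \<subseteq> sigma_in L" and D: "D \<in> \<D>"
  shows "nice \<sigma> D (toast_eval (derandomized \<sigma>) \<D> D)"
  using D
proof (induction "card D" arbitrary: D rule: less_induct)
  case (less D)
  have part: "partial_toast q \<D>"
    using toast toast_noncrossing_iff by blast
  note pieces = partial_toastD[OF part]
  have ext: "extending (sigma_out L) (derandomized \<sigma>) \<D>"
    using part \<sigma> by (rule derandomized_extending)
  have fin: "finite D"
    using pieces(2)[OF less.prems] .
  let ?c = "sub_eval (derandomized \<sigma>) \<D> D"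
  have "nice \<sigma> E (toast_eval (derandomized \<sigma>) \<D> E)" if "E \<in> \<D>" "E \<subset> D" for E
    using psubset_card_mono[OF fin that(2)] that(1) by (rule less.hyps)
  from nice_extension_exists[OF toast less.prems \<sigma> ext this]
  obtain e where "toast_extension L D ?c e" "nice \<sigma> D e"
    by blast
  moreover have "toast_input L D \<sigma> ?c"
    using pieces(2,3)[OF less.prems] toast_eval_extends(3,4)[OF pieces(1,5) ext less.prems] \<sigma>
    by (auto simp: toast_input_def)
  ultimately have "nice \<sigma> D (derandomized \<sigma> D ?c)"
    using derandomized(2) by blast
  then show ?case
    using fin by (simp add: toast_eval_finite)
qed

lemma derandomized_solves:
  assumes toast: "toast q \<D>" "noncrossing \<D>" and \<sigma>: "range \<sigma> \<subseteq> sigma_in L"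
    and R: "AE \<omega> in random_labels UNIV.
      \<forall>\<D>. toast q \<D> \<and> noncrossing \<D> \<longrightarrow> solves_on L \<sigma> (R \<sigma> \<omega>) \<D>"
  shows "solves_on L \<sigma> (derandomized \<sigma>) \<D>"
proof -
  let ?F = "derandomized \<sigma>"
  have part: "partial_toast q \<D>"
    using toast toast_noncrossing_iff by blast
  note pieces = partial_toastD[OF part]
  have ext: "extending (sigma_out L) ?F \<D>"
    using part \<sigma> by (rule derandomized_extending)
  note ev = toast_eval_extends[OF pieces(1,5) ext]
  note out = toast_output_apply[OF pieces(1,5) ext]
  define f where "f x = the (toast_output ?F \<D> x)" for x
  have f: "toast_output ?F \<D> x = Some (f x) \<and> f x \<in> sigma_out L" for x
  proof -
    obtain D where D: "D \<in> \<D>" "x \<in> D"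
      using toast(1) unfolding toast_def by blast
    then obtain y where "toast_eval ?F \<D> D x = Some y"
      using ev(1)[OF D(1)] by blast
    then show ?thesis
      using out[OF D] ev(2)[OF D(1)] by (auto simp: f_def intro: ranI)
  qed
  \<comment> \<open>A coloring is judged one ball at a time, so the surgered toast, the labels and
    the coloring \<open>f'\<close> compared with \<open>f\<close> may depend on
    \<open>v\<close>.\<close>
  have "\<exists>p\<in>patterns L. \<exists>\<phi>. grid_iso (grid_ball v (radius L)) (grid_ball 0 (radius L)) \<phi> \<and> \<phi> v = 0 \<and>
      (\<forall>x\<in>grid_ball v (radius L). p (\<phi> x) = (\<sigma> x, f x))" for v
  proof -
    let ?ball = "grid_ball v (radius L)"
    obtain D where D: "D \<in> \<D>" "?ball \<subseteq> D"
      using toast_contains_finite[OF toast finite_grid_ball[OF toast(1)]] by blast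
    obtain H S where H: "history D H" and S: "S \<in> sets (random_labels D)"
      "measure (random_labels D) S > 0"
      and e: "\<And>\<omega>. \<omega> \<in> S \<Longrightarrow> toast_eval (R \<sigma> \<omega>) H D = toast_eval ?F \<D> D"
      using nice_derandomized[OF toast \<sigma> D(1)] unfolding nice_def by blast
    define K where "K = glue \<D> {D} (\<lambda>_. H)"
    have K: "toast q K" "noncrossing K" "{G \<in> K. G \<subseteq> D} = H"
      using glue_toast[OF toast, of "{D}" "\<lambda>_. H"] D(1) H by (simp_all add: K_def history_def)
    have Kpart: "partial_toast q K"
      using K(1,2) toast_noncrossing_iff by blast
    have DK: "D \<in> K"
      using K(3) H by (auto simp: history_def)
    let ?S = "{\<omega> \<in> space (random_labels UNIV). restrict \<omega> D \<in> S}"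
    have S': "?S \<in> sets (random_labels UNIV)" "measure (random_labels UNIV) ?S > 0"
      using measure_PiM_reindex[where f = "\<lambda>i. i" and K = UNIV and I = D and S = S
          and M = "\<lambda>_. unit_uniform"] prob_space_unit_uniform S by auto
    \<comment> \<open>An almost sure property must hold somewhere on an event of positive
      probability. Only \<open>?S\<close> has to be measurable for this, not the set of successful
      labels.\<close>
    have "\<exists>\<omega>\<in>?S. solves_on L \<sigma> (R \<sigma> \<omega>) K"
    proof (rule ccontr)
      assume none: "\<not> (\<exists>\<omega>\<in>?S. solves_on L \<sigma> (R \<sigma> \<omega>) K)"
      have "\<omega> \<notin> ?S"
        if "\<forall>\<D>. toast q \<D> \<and> noncrossing \<D> \<longrightarrow> solves_on L \<sigma> (R \<sigma> \<omega>) \<D>" for \<omega>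
        using that[rule_format, OF conjI[OF K(1,2)]] none by blast
      with R have "AE \<omega> in random_labels UNIV. \<omega> \<notin> ?S"
        by (rule eventually_mono)
      then have "measure (random_labels UNIV) ?S = 0"
        using S'(1) labels.prob_eq_0 by blast
      then show False
        using S'(2) by simp
    qed
    then obtain \<omega> where \<omega>: "\<omega> \<in> ?S" "solves_on L \<sigma> (R \<sigma> \<omega>) K"
      by blast
    then obtain f' where f': "toast_output (R \<sigma> \<omega>) K = (\<lambda>x. Some (f' x))" "is_coloring L \<sigma> f'"
      unfolding solves_on_def by blast
    have unit: "\<omega> ` A \<subseteq> {0..1}" for A
      using \<omega>(1) space_random_labels[of \<omega> UNIV] by blast
    have Kext: "extending (sigma_out L) (R \<sigma> \<omega>) K"
      using Kpart _ _ unit[of UNIV] by (rule R_extending) (use \<sigma> in auto)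
    have "f' x = f x" if "x \<in> D" for x
    proof -
      have "Some (f' x) = toast_eval (R \<sigma> \<omega>) K D x"
        using toast_output_apply[OF partial_toastD(1,5)[OF Kpart] Kext DK that] f'(1) by simp
      also have "toast_eval (R \<sigma> \<omega>) K D = toast_eval (R \<sigma> (restrict \<omega> D)) H D"
        using H _ unit K(3) by (rule eval_restrict) (use \<sigma> in auto)
      also have "\<dots> = toast_eval ?F \<D> D"
        using \<omega>(1) e by blast
      also have "\<dots> x = Some (f x)"
        using out[OF D(1) that] f by simp
      finally show ?thesis by simp
    qed
    then have "\<And>x. x \<in> ?ball \<Longrightarrow> f' x = f x"
      using D(2) by blast
    moreover obtain p \<phi> where "p \<in> patterns L" "grid_iso ?ball (grid_ball 0 (radius L)) \<phi>" "\<phi> v = 0"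
      "\<forall>x\<in>?ball. p (\<phi> x) = (\<sigma> x, f' x)"
      using f'(2) unfolding is_coloring_def by blast
    ultimately show ?thesis
      by (intro bexI[of _ p] exI[of _ \<phi>]) auto
  qed
  then have "is_coloring L \<sigma> f"
    using \<sigma> f by (auto simp: is_coloring_def)
  then show ?thesis
    unfolding solves_on_def using f by (intro exI[of _ f]) (simp add: fun_eq_iff)
qed

end

theorem theorem4p6:
  fixes L :: "('i, 'o, 'd::finite) lcl"
  assumes "is_lcl L"
  shows "L \<in> RTOAST \<longleftrightarrow> L \<in> TOAST"
proof
  assume "L \<in> RTOAST"
  then obtain q R where q: "q > 0" and alg: "randomized_toast_algorithm L R"
    and R: "\<And>\<sigma>. range \<sigma> \<subseteq> sigma_in L \<Longrightarrow> AE \<omega> in PiM UNIV (\<lambda>_. unit_uniform).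
      \<forall>\<D>. toast q \<D> \<and> noncrossing \<D> \<longrightarrow> solves_on L \<sigma> (R \<sigma> \<omega>) \<D>"
    unfolding RTOAST_def by blast
  interpret randomized_algorithm L R q
    using assms alg by unfold_locales
  have "solves_on L \<sigma> (derandomized \<sigma>) \<D>"
    if "range \<sigma> \<subseteq> sigma_in L" "toast q \<D> \<and> noncrossing \<D>" for \<sigma> \<D>
    by (rule derandomized_solves[OF _ _ that(1) R[OF that(1)]]) (use that(2) in simp_all)
  then show "L \<in> TOAST"
    unfolding TOAST_def using q toast_algorithm_derandomized by blast
next
  assume "L \<in> TOAST"
  then obtain q \<A> where q: "q > 0" and alg: "toast_algorithm L \<A>"
    and \<A>: "\<And>\<sigma> \<D>. range \<sigma> \<subseteq> sigma_in L \<Longrightarrow> toast q \<D> \<and> noncrossing \<D> \<Longrightarrow> solves_on L \<sigma> (\<A> \<sigma>) \<D>"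
    unfolding TOAST_def by blast
  \<comment> \<open>A deterministic algorithm becomes a randomized one that ignores its labels; as a
    function of them it is constant, hence measurable.\<close>
  have "randomized_toast_algorithm L (\<lambda>\<sigma> _. \<A> \<sigma>)"
    using alg unfolding randomized_toast_algorithm_def toast_algorithm_def by simp
  then show "L \<in> RTOAST"
    unfolding RTOAST_def using q \<A> by (intro CollectI exI[of _ q] conjI exI[of _ "\<lambda>\<sigma> _. \<A> \<sigma>"]) auto
qed

end
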